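(* For every $\epsilon>0$ the following holds in the value oracle model: there exist instances of the problem $\max\{f(S): S\in\mathcal{B}\}$, where $f$ is a nonnegative submodular function and $\mathcal{B}$ is the collection of bases of a matroid whose fractional base packing number is at least $2$, such that any algorithm achieving a $(1-e^{-1/2}+\epsilon)$-approximation for these instances requires exponentially many value queries.
   Context: $f:2^X\to\mathbb{R}_+$ is submodular if $f(S\cup T)+f(S\cap T)\le f(S)+f(T)$; in the value oracle model the algorithm accesses $f$ only through queries returning $f(S)$. The fractional base packing number of a matroid with base family $\mathcal{B}$ is $\max\{\sum_{B\in\mathcal{B}}\lambda_B : \sum_{B\in\mathcal{B}}\lambda_B\mathbf{1}_B\le\mathbf{1},\ \lambda\ge0\}$. An $\alpha$-approximation returns a feasible $S$ with $f(S)\ge\alpha\cdot\max\{f(S'):S'\in\mathcal{B}\}$. *)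

theory Defs
  imports "HOL-Probability.Probability"
begin

definition matroid :: "'a set \<Rightarrow> 'a set set \<Rightarrow> bool" where
  "matroid X \<J> \<longleftrightarrow>
     finite X \<and> \<J> \<subseteq> Pow X \<and> {} \<in> \<J> \<and>
     (\<forall>S T. S \<in> \<J> \<and> T \<subseteq> S \<longrightarrow> T \<in> \<J>) \<and>
     (\<forall>S\<in>\<J>. \<forall>T\<in>\<J>. card S < card T \<longrightarrow> (\<exists>x\<in>T - S. insert x S \<in> \<J>))"

definition bases :: "'a set set \<Rightarrow> 'a set set" where
  "bases \<J> = {B \<in> \<J>. \<forall>C\<in>\<J>. B \<subseteq> C \<longrightarrow> C = B}"

text \<open>The value lies in the extended reals because the linear program is unbounded for a matroid
  of rank 0 (its only base is the empty set). In all other cases the maximum exists and equals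
  this supremum.\<close>

definition fractional_base_packing_number :: "'a set \<Rightarrow> 'a set set \<Rightarrow> ereal" where
  "fractional_base_packing_number X \<J> =
     Sup {ereal (\<Sum>B\<in>bases \<J>. w B) | w.
            (\<forall>B\<in>bases \<J>. 0 \<le> w B) \<and>
            (\<forall>x\<in>X. (\<Sum>B\<in>bases \<J>. w B * indicator B x) \<le> 1)}"

definition submodular_on :: "'a set \<Rightarrow> ('a set \<Rightarrow> real) \<Rightarrow> bool" where
  "submodular_on X f \<longleftrightarrow> (\<forall>S T. S \<subseteq> X \<and> T \<subseteq> X \<longrightarrow> f (S \<union> T) + f (S \<inter> T) \<le> f S + f T)"

definition nonnegative_on :: "'a set \<Rightarrow> ('a set \<Rightarrow> real) \<Rightarrow> bool" where
  "nonnegative_on X f \<longleftrightarrow> (\<forall>S. S \<subseteq> X \<longrightarrow> 0 \<le> f S)"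

text \<open>An instance \<open>(X, \<J>, f)\<close> of \<open>max {f S | S \<in> bases \<J>}\<close>: ground set, independent sets,
  objective. Only the values of \<open>f\<close> on subsets of \<open>X\<close> matter.\<close>

type_synonym 'a base_instance = "'a set \<times> 'a set set \<times> ('a set \<Rightarrow> real)"

definition submodular_base_instance :: "'a base_instance \<Rightarrow> bool" where
  "submodular_base_instance = (\<lambda>(X, \<J>, f).
     matroid X \<J> \<and> nonnegative_on X f \<and> submodular_on X f)"

definition opt_value :: "'a base_instance \<Rightarrow> real" where
  "opt_value = (\<lambda>(X, \<J>, f). Max (f ` bases \<J>))"

text \<open>A deterministic algorithm in the value oracle model, as an adaptive query strategy:
  \<open>Query S k\<close> asks for the value of \<open>S\<close> and continues with \<open>k r\<close> on answer \<open>r\<close>.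
  Computation between queries is unrestricted.\<close>

datatype 'a query_strategy =
    Answer "'a set"
  | Query "'a set" "real \<Rightarrow> 'a query_strategy"

primrec answer :: "('a set \<Rightarrow> real) \<Rightarrow> 'a query_strategy \<Rightarrow> 'a set" where
  "answer f (Answer S) = S"
| "answer f (Query S k) = answer f (k (f S))"

primrec num_queries :: "('a set \<Rightarrow> real) \<Rightarrow> 'a query_strategy \<Rightarrow> nat" where
  "num_queries f (Answer S) = 0"
| "num_queries f (Query S k) = Suc (num_queries f (k (f S)))"

primrec queries_within :: "'a set \<Rightarrow> 'a query_strategy \<Rightarrow> bool" where
  "queries_within X (Answer S) \<longleftrightarrow> True"
| "queries_within X (Query S k) \<longleftrightarrow> S \<subseteq> X \<and> (\<forall>r. queries_within X (k r))"

text \<open>A (possibly randomized) algorithm is told the ground set and the matroid explicitly and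
  draws a query strategy; the objective is accessible only through the queries. Deterministic
  algorithms are the point distributions \<open>return_pmf\<close>.\<close>

type_synonym 'a value_oracle_algorithm = "'a set \<Rightarrow> 'a set set \<Rightarrow> 'a query_strategy pmf"

text \<open>The returned set is always a base; its value is measured in expectation over the internal
  randomness, which for point distributions is the value itself.\<close>

definition achieves_approximation ::
    "real \<Rightarrow> 'a value_oracle_algorithm \<Rightarrow> 'a base_instance \<Rightarrow> bool" where
  "achieves_approximation \<alpha> A = (\<lambda>(X, \<J>, f).
     (\<forall>t\<in>set_pmf (A X \<J>). queries_within X t \<and> answer f t \<in> bases \<J>) \<and>
     measure_pmf.expectation (A X \<J>) (\<lambda>t. f (answer f t)) \<ge> \<alpha> * opt_value (X, \<J>, f))"

text \<open>Worst case over the internal randomness.\<close>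

definition makes_at_least_queries ::
    "real \<Rightarrow> 'a value_oracle_algorithm \<Rightarrow> 'a base_instance \<Rightarrow> bool" where
  "makes_at_least_queries q A = (\<lambda>(X, \<J>, f). \<exists>t\<in>set_pmf (A X \<J>). q \<le> real (num_queries f t))"

text \<open>The family has instances of arbitrarily large size \<open>n = |X|\<close>, and at every size occurring
  in it some instance forces \<open>2 powr (c * n)\<close> queries, with the rate \<open>c > 0\<close> independent of the
  algorithm.\<close>

definition requires_exponentially_many_queries :: "real \<Rightarrow> 'a base_instance set \<Rightarrow> bool" where
  "requires_exponentially_many_queries \<alpha> \<P> \<longleftrightarrow>
     infinite ((\<lambda>P. card (fst P)) ` \<P>) \<and>
     (\<exists>c>0. \<forall>A. (\<forall>P\<in>\<P>. achieves_approximation \<alpha> A P) \<longrightarrow>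
        (\<forall>n \<in> (\<lambda>P. card (fst P)) ` \<P>. \<exists>P\<in>\<P>. card (fst P) = n \<and>
            makes_at_least_queries (2 powr (c * real n)) A P))"

end

theory Submission
  imports Defs
begin

text \<open>Consider blocks \<open>a\<close>, \<open>b\<close>, \<open>a\<^sub>1, \<dots>, a\<^sub>k\<close>, \<open>b\<^sub>1, \<dots>, b\<^sub>k\<close>, the constraint of choosing mass 1 from
  \<open>a \<union> b\<close> and mass 1 from the other blocks, and the multilinear cut function
  \<open>(1 - x\<^sub>a) (1 - \<Prod>i. (1 - x\<^sub>a\<^sub>i)) + (1 - x\<^sub>b) (1 - \<Prod>i. (1 - x\<^sub>b\<^sub>i))\<close>. Choosing \<open>b\<close> and \<open>a\<^sub>1\<close>
  gives 1, whereas a point at which all blocks are treated alike gives only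
  \<open>1 - (1 - 1 / (2 k))\<^sup>k\<close>, which tends to \<open>1 - exp (- 1 / 2)\<close>.

  The partition into blocks is hidden at random. A fixed query is balanced with respect to it up to
  exponentially small probability, so it suffices to modify the function such that it equals its
  symmetrization on all nearly balanced sets. The function and its symmetrization agree to second
  order at balanced points. Interpolating between them by a cutoff that depends on the logarithm of
  the imbalance therefore perturbs second derivatives by an arbitrarily small amount only, which a
  small multiple of a symmetric concave function absorbs. Averaging over the hidden partition
  shows that few queries cannot beat the value of the symmetrization.\<close>

subsection \<open>Partial derivatives and mixed differences\<close>

text \<open>Near balanced points the gap \<open>skewed - symm\<close> is of the order of the
  imbalance \<open>D\<close>, while the gradients of the gap and of \<open>D\<close> are of the
  order of its square root. The errors in the second derivatives are therefore controlled by
  \<open>t * \<phi>' t\<close> and \<open>t\<^sup>2 * \<phi>'' t\<close> at \<open>t = D\<close>. As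
  \<open>1 / t\<close> is not integrable at 0, a weight \<open>\<phi>\<close> can climb from 0 to 1
  with both quantities as small as desired; the price is the tiny threshold
  \<open>exp (- 1 / a)\<close>. This is affordable because \<open>a\<close> depends only on
  \<epsilon> and the number of blocks: the threshold stays constant while the ground set grows, and
  a fixed query exceeds it with probability exponentially small in the size. The algorithm is told
  the matroid, so the constraint must not betray the partition. It refers only to the selector block
  and its complement, which are public. The margin \<epsilon> pays for three errors below or equal
  to \<open>\<epsilon> / 4\<close>: the finite number of blocks, the added concave function, and the
  rare unbalanced queries.\<close>

definition bump :: "(nat \<Rightarrow> real) \<Rightarrow> nat \<Rightarrow> real \<Rightarrow> nat \<Rightarrow> real" where
  "bump v i t = v(i := v i + t)"

lemma bump_apply: "bump v i t j = v j + (if i = j then t else 0)"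
  by (simp add: bump_def)

lemma bump_0 [simp]: "bump v i 0 = v"
  by (simp add: bump_def)

lemma bump_add: "bump (bump v i s) i t = bump v i (s + t)"
  by (simp add: bump_def add.assoc)

lemma bump_commute: "bump (bump v i s) j t = bump (bump v j t) i s"
  by (auto simp: bump_def fun_eq_iff)

text \<open>Asking for the derivative at 0 only, but for every \<open>v\<close>, is enough:
  \<open>has_partial_at\<close> moves the base point along the line.\<close>

definition has_partial ::
    "((nat \<Rightarrow> real) \<Rightarrow> real) \<Rightarrow> nat \<Rightarrow> ((nat \<Rightarrow> real) \<Rightarrow> real) \<Rightarrow> bool" where
  "has_partial g i g' \<longleftrightarrow>
     (\<forall>v. ((\<lambda>t. g (bump v i t)) has_real_derivative g' v) (at 0))"

lemma has_partial_at:
  assumes "has_partial g i g'"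
  shows "((\<lambda>t. g (bump v i t)) has_real_derivative g' (bump v i t)) (at t)"
proof -
  have "((\<lambda>s. g (bump (bump v i t) i s)) has_real_derivative g' (bump v i t)) (at 0)"
    using assms by (simp add: has_partial_def)
  then have "((\<lambda>s. g (bump v i (s + t))) has_real_derivative g' (bump v i t)) (at 0)"
    by (simp add: bump_add add.commute)
  then show ?thesis
    using DERIV_shift[of "\<lambda>t. g (bump v i t)" "g' (bump v i t)" 0 t] by simp
qed

text \<open>The second difference is the integral of the mixed derivative over a square of side
  \<open>h\<close>, here replaced by two uses of monotonicity; a sign on that square suffices. The
  case \<open>i = j\<close> is included and covers two elements of the same class.\<close>

lemma mixed_difference_nonpos:
  assumes gi: "has_partial g i gi" and gij: "has_partial gi j gij" and h: "0 \<le> h"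
    and neg: "\<And>s t. \<lbrakk>0 \<le> s; s \<le> h; 0 \<le> t; t \<le> h\<rbrakk> \<Longrightarrow> gij (bump (bump v i s) j t) \<le> 0"
  shows "g (bump (bump v i h) j h) + g v \<le> g (bump v i h) + g (bump v j h)"
proof -
  have mono: "gi (bump (bump v i s) j h) \<le> gi (bump v i s)" if "0 \<le> s" "s \<le> h" for s
    using DERIV_nonpos_imp_nonincreasing[OF h, of "\<lambda>t. gi (bump (bump v i s) j t)"]
      has_partial_at[OF gij] neg that by fastforce
  have "g (bump (bump v j h) i h) - g (bump v i h)
      \<le> g (bump (bump v j h) i 0) - g (bump v i 0)"
  proof (rule DERIV_nonpos_imp_nonincreasing[OF h])
    fix s assume s: "0 \<le> s" "s \<le> h"
    show "\<exists>y. ((\<lambda>s. g (bump (bump v j h) i s) - g (bump v i s)) has_real_derivative y) (at s)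
            \<and> y \<le> 0"
      by (rule exI, rule conjI, rule DERIV_diff[OF has_partial_at[OF gi] has_partial_at[OF gi]])
        (use mono[OF s] in \<open>simp add: bump_commute[of v j h]\<close>)
  qed
  then show ?thesis by (simp add: bump_commute[of v j h])
qed

lemma has_partial_cong:
  assumes "has_partial g i g'" "\<And>v. g' v = g'' v"
  shows "has_partial g i g''"
  using assms by (simp add: has_partial_def)

text \<open>A separate constant, since the simplifier would split \<open>of_bool\<close> into cases.\<close>

definition kron :: "nat \<Rightarrow> nat \<Rightarrow> real" where "kron i j = of_bool (i = j)"

lemma DERIV_bump_coord [derivative_intros]:
  "((\<lambda>t. bump v i t j) has_real_derivative kron i j) (at 0)"
proof -
  have "((\<lambda>t. v j + t * kron i j) has_real_derivative kron i j) (at 0)"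
    by (auto intro!: derivative_eq_intros)
  then show ?thesis by (simp add: bump_apply kron_def of_bool_def if_distrib cong: if_cong)
qed

subsection \<open>A cutoff on a logarithmic scale\<close>

text \<open>The logarithm makes \<open>t * cutoff' a t\<close> and \<open>t\<^sup>2 * cutoff'' a t\<close> of order \<open>a\<close>, and the cube makes
  the function twice differentiable at the threshold \<open>exp (- 1 / a)\<close>.\<close>

definition cutoff :: "real \<Rightarrow> real \<Rightarrow> real" where
  "cutoff a t = (if t \<le> 0 then 0 else (max 0 (1 + a * ln t)) ^ 3)"

definition cutoff' :: "real \<Rightarrow> real \<Rightarrow> real" where
  "cutoff' a t = (if t \<le> 0 then 0 else 3 * a * (max 0 (1 + a * ln t))\<^sup>2 / t)"

definition cutoff'' :: "real \<Rightarrow> real \<Rightarrow> real" where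
  "cutoff'' a t = (if t \<le> 0 then 0 else
     (6 * a\<^sup>2 * max 0 (1 + a * ln t) - 3 * a * (max 0 (1 + a * ln t))\<^sup>2) / t\<^sup>2)"

text \<open>The critical point is the kink at 0, where an exponent of at least 2 bounds the
  difference quotient by \<open>(max 0 h) ^ (m + 1)\<close>.\<close>

lemma DERIV_max0_power:
  "((\<lambda>x::real. (max 0 x) ^ (m + 2)) has_real_derivative real (m + 2) * (max 0 x) ^ (m + 1)) (at x)"
proof -
  consider "x > 0" | "x < 0" | "x = 0" by linarith
  then show ?thesis
  proof cases
    case 1
    have "((\<lambda>x::real. x ^ (m + 2)) has_real_derivative real (m + 2) * (max 0 x) ^ (m + 1)) (at x)"
      using 1 DERIV_pow[of "m + 2" x] by (simp add: max_def)
    then show ?thesis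
      by (rule DERIV_cong_ev[THEN iffD1, rotated -1, OF _ refl _ refl])
        (use eventually_nhds_in_open[of "{0<..}" x] 1
          in \<open>auto elim!: eventually_mono\<close>)
  next
    case 2
    have "((\<lambda>x::real. 0) has_real_derivative real (m + 2) * (max 0 x) ^ (m + 1)) (at x)"
      using 2 by simp
    then show ?thesis
      by (rule DERIV_cong_ev[THEN iffD1, rotated -1, OF _ refl _ refl])
        (use eventually_nhds_in_open[of "{..<0}" x] 2 in \<open>auto elim!: eventually_mono\<close>)
  next
    case 3
    have "(\<lambda>h::real. (max 0 h) ^ (m + 1)) \<midarrow>0\<rightarrow> (max 0 0) ^ (m + 1)"
      by (intro tendsto_intros)
    then have lim: "(\<lambda>h::real. (max 0 h) ^ (m + 1)) \<midarrow>0\<rightarrow> 0" by simp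
    have "norm ((max 0 h) ^ (m + 2) / h) \<le> (max 0 h) ^ (m + 1)" for h :: real
      by (auto simp: max_def field_simps)
    then have "\<forall>\<^sub>F h::real in at 0. norm ((max 0 h) ^ (m + 2) / h) \<le> (max 0 h) ^ (m + 1)"
      by (rule eventuallyI)
    from Lim_null_comparison[OF this lim]
    have "(\<lambda>h::real. (max 0 h) ^ (m + 2) / h) \<midarrow>0\<rightarrow> 0" .
    then show ?thesis using 3 by (simp add: DERIV_def)
  qed
qed

lemma cutoff_eq_0:
  assumes "0 < a" "t \<le> exp (- 1 / a)"
  shows "cutoff a t = 0" "cutoff' a t = 0" "cutoff'' a t = 0"
proof -
  have "max 0 (1 + a * ln t) = 0" if "0 < t"
  proof -
    have "ln t \<le> - 1 / a" using assms that by (metis ln_exp ln_mono)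
    then show ?thesis using assms by (simp add: field_simps)
  qed
  then show "cutoff a t = 0" "cutoff' a t = 0" "cutoff'' a t = 0"
    by (auto simp: cutoff_def cutoff'_def cutoff''_def)
qed

text \<open>The open sets \<open>t < exp (- 1 / a)\<close> and \<open>0 < t\<close> cover the line.
  On the former everything vanishes identically, so the case split at 0 does no harm.\<close>

lemma DERIV_cutoff:
  assumes "0 < a"
  shows "(cutoff a has_real_derivative cutoff' a t) (at t)"
    and "(cutoff' a has_real_derivative cutoff'' a t) (at t)"
proof -
  have small: "(cutoff a has_real_derivative cutoff' a t) (at t)
      \<and> (cutoff' a has_real_derivative cutoff'' a t) (at t)" if t: "t < exp (- 1 / a)"
  proof -
    have ev: "\<forall>\<^sub>F x in nhds t. x < exp (- 1 / a)"
      using eventually_nhds_in_open[of "{..<exp (- 1 / a)}" t] t by simp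
    have "((\<lambda>_. 0) has_real_derivative 0) (at t)" by simp
    then have "(cutoff a has_real_derivative 0) (at t)" "(cutoff' a has_real_derivative 0) (at t)"
      by (rule DERIV_cong_ev[THEN iffD1, rotated -1, OF _ refl _ refl];
          use ev in \<open>auto elim!: eventually_mono simp: cutoff_eq_0[OF assms]\<close>)+
    then show ?thesis using cutoff_eq_0[OF assms, of t] t by simp
  qed
  have pos: "(cutoff a has_real_derivative cutoff' a t) (at t)
      \<and> (cutoff' a has_real_derivative cutoff'' a t) (at t)" if t: "0 < t"
  proof -
    have ev: "\<forall>\<^sub>F x in nhds t. 0 < x"
      using eventually_nhds_in_open[of "{0<..}" t] t by simp
    have u: "((\<lambda>t. 1 + a * ln t) has_real_derivative a / t) (at t)"
      using t by (auto intro!: derivative_eq_intros)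
    note cube = DERIV_chain2[OF DERIV_max0_power[of 1] u]
      and square = DERIV_chain2[OF DERIV_max0_power[of 0] u]
    have "((\<lambda>t. (max 0 (1 + a * ln t)) ^ 3) has_real_derivative cutoff' a t) (at t)"
      using cube t by (simp add: cutoff'_def power2_eq_square eval_nat_numeral field_simps)
    then have "(cutoff a has_real_derivative cutoff' a t) (at t)"
      by (rule DERIV_cong_ev[THEN iffD1, rotated -1, OF _ refl _ refl])
        (use ev in \<open>auto elim!: eventually_mono simp: cutoff_def\<close>)
    moreover have "((\<lambda>t. 3 * a * (max 0 (1 + a * ln t))\<^sup>2 / t) has_real_derivative
        (3 * a * (2 * max 0 (1 + a * ln t) * (a / t)) * t - 3 * a * (max 0 (1 + a * ln t))\<^sup>2)
          / (t * t)) (at t)"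
      using DERIV_divide[OF DERIV_cmult[OF square, of "3 * a"] DERIV_ident] t
      by (simp add: power2_eq_square)
    then have "((\<lambda>t. 3 * a * (max 0 (1 + a * ln t))\<^sup>2 / t) has_real_derivative cutoff'' a t) (at t)"
      using t by (simp add: cutoff''_def power2_eq_square algebra_simps)
    then have "(cutoff' a has_real_derivative cutoff'' a t) (at t)"
      by (rule DERIV_cong_ev[THEN iffD1, rotated -1, OF _ refl _ refl])
        (use ev in \<open>auto elim!: eventually_mono simp: cutoff'_def\<close>)
    ultimately show ?thesis by simp
  qed
  show "(cutoff a has_real_derivative cutoff' a t) (at t)"
    "(cutoff' a has_real_derivative cutoff'' a t) (at t)"
    using small pos by (cases "0 < t"; force intro: le_less_trans[of t 0])+
qed

lemma cutoff_bounds: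
  assumes "0 < a" "a \<le> 1" "0 \<le> t" "t \<le> 1"
  shows "0 \<le> cutoff a t" "cutoff a t \<le> 1" "t * \<bar>cutoff' a t\<bar> \<le> 3 * a"
    "t\<^sup>2 * \<bar>cutoff'' a t\<bar> \<le> 9 * a"
proof -
  \<comment> \<open>For positive \<open>t\<close>, \<open>t * cutoff' a t\<close> is
    \<open>3 * a * u\<^sup>2\<close> and \<open>t\<^sup>2 * cutoff'' a t\<close> is
    \<open>6 * a\<^sup>2 * u - 3 * a * u\<^sup>2\<close>. Since \<open>u\<close> and
    \<open>a\<close> are at most 1, this gives \<open>3 * a\<close> and
    \<open>6 * a + 3 * a\<close>.\<close>
  define u where "u = max 0 (1 + a * ln t)"
  have u: "0 \<le> u" "u \<le> 1" if "0 < t"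
    using that assms by (auto simp: u_def mult_le_0_iff)
  show "0 \<le> cutoff a t" "cutoff a t \<le> 1"
    using u by (auto simp: cutoff_def u_def[symmetric] power_le_one)
  show "t * \<bar>cutoff' a t\<bar> \<le> 3 * a"
    using u assms by (auto simp: cutoff'_def u_def[symmetric] power_le_one abs_mult)
  have "\<bar>6 * a\<^sup>2 * u - 3 * a * u\<^sup>2\<bar> \<le> 9 * a" if "0 < t"
  proof -
    have "0 \<le> a\<^sup>2 * u" "a\<^sup>2 * u \<le> a * 1"
      using u[OF that] assms by (auto simp: power2_eq_square intro!: mult_mono mult_le_one)
    moreover have "0 \<le> a * u\<^sup>2" "a * u\<^sup>2 \<le> a * 1"
      using u[OF that] assms by (auto intro!: mult_left_mono power_le_one)
    ultimately show ?thesis by (intro abs_leI) linarith+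
  qed
  then show "t\<^sup>2 * \<bar>cutoff'' a t\<bar> \<le> 9 * a"
    using assms by (auto simp: cutoff''_def u_def[symmetric])
qed

text \<open>The hidden optimum has imbalance exactly 1, so there the weight falls entirely on the
  skewed function.\<close>

lemma cutoff_1 [simp]: "cutoff a 1 = 1"
  by (simp add: cutoff_def)

subsection \<open>The skewed and the symmetric objective\<close>

text \<open>Coordinates 0 and 1 are the masses of the two sides of the selector block, coordinate 2 the
  mass of the hidden optimal block, coordinate 3 the mass of the remaining \<open>l + 1\<close> blocks of its
  side, and coordinate 4 the mass of the \<open>l + 2\<close> blocks of the other side; every block has
  mass 1. Instead of \<open>1 - \<Prod>i. (1 - x i)\<close> over all blocks of a side it suffices to single
  out one block, because the gradients of \<open>skewed\<close> and \<open>symm\<close> still agree at balanced points.\<close>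

definition resP :: "(nat \<Rightarrow> real) \<Rightarrow> real" where "resP v = 1 - v 2"
definition resQ :: "nat \<Rightarrow> (nat \<Rightarrow> real) \<Rightarrow> real" where "resQ l v = 1 - v 3 / real (l + 1)"
definition resR :: "nat \<Rightarrow> (nat \<Rightarrow> real) \<Rightarrow> real" where "resR l v = 1 - v 4 / real (l + 2)"
definition resZ :: "nat \<Rightarrow> (nat \<Rightarrow> real) \<Rightarrow> real" where
  "resZ l v = 1 - (v 2 + v 3 + v 4) / (2 * real (l + 2))"

definition skewed :: "nat \<Rightarrow> (nat \<Rightarrow> real) \<Rightarrow> real" where
  "skewed l v = (1 - v 0) * (1 - resP v * resQ l v ^ (l + 1)) + (1 - v 1) * (1 - resR l v ^ (l + 2))"

definition skewed' :: "nat \<Rightarrow> nat \<Rightarrow> (nat \<Rightarrow> real) \<Rightarrow> real" where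
  "skewed' l i v =
     - kron i 0 * (1 - resP v * resQ l v ^ (l + 1))
     + (1 - v 0) * (kron i 2 * resQ l v ^ (l + 1) + kron i 3 * (resP v * resQ l v ^ l))
     - kron i 1 * (1 - resR l v ^ (l + 2)) + (1 - v 1) * (kron i 4 * resR l v ^ (l + 1))"

text \<open>Written as minus a sum of products that are nonnegative on the box, so that the sign can
  be read off. For \<open>l = 0\<close> the truncated exponent \<open>l - 1\<close> is harmless
  because of the factor \<open>real l\<close>.\<close>

definition skewed'' :: "nat \<Rightarrow> nat \<Rightarrow> nat \<Rightarrow> (nat \<Rightarrow> real) \<Rightarrow> real" where
  "skewed'' l i j v = - (
     kron i 0 * (kron j 2 * resQ l v ^ (l + 1) + kron j 3 * (resP v * resQ l v ^ l))
     + kron j 0 * (kron i 2 * resQ l v ^ (l + 1) + kron i 3 * (resP v * resQ l v ^ l))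
     + (1 - v 0) * ((kron i 2 * kron j 3 + kron i 3 * kron j 2) * resQ l v ^ l
         + kron i 3 * kron j 3 * (resP v * (real l * resQ l v ^ (l - 1) / real (l + 1))))
     + (kron i 1 * kron j 4 + kron i 4 * kron j 1) * resR l v ^ (l + 1)
     + (1 - v 1) * (kron i 4 * kron j 4 * (real (l + 1) * resR l v ^ l / real (l + 2))))"

definition selector_coord :: "nat \<Rightarrow> real" where "selector_coord i = kron i 0 + kron i 1"
definition main_coord :: "nat \<Rightarrow> real" where "main_coord i = kron i 2 + kron i 3 + kron i 4"

text \<open>This is \<open>skewed\<close> with \<open>v 0\<close> and \<open>v 1\<close> replaced by
  their mean and every residual by \<open>resZ\<close>. It depends only on the totals
  \<open>v 0 + v 1\<close> and \<open>v 2 + v 3 + v 4\<close>, which carry no information about the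
  partition.\<close>

definition symm :: "nat \<Rightarrow> (nat \<Rightarrow> real) \<Rightarrow> real" where
  "symm l v = (2 - v 0 - v 1) * (1 - resZ l v ^ (l + 2))"

definition symm' :: "nat \<Rightarrow> nat \<Rightarrow> (nat \<Rightarrow> real) \<Rightarrow> real" where
  "symm' l i v = - selector_coord i * (1 - resZ l v ^ (l + 2))
     + (2 - v 0 - v 1) * (main_coord i / 2 * resZ l v ^ (l + 1))"

definition symm'' :: "nat \<Rightarrow> nat \<Rightarrow> nat \<Rightarrow> (nat \<Rightarrow> real) \<Rightarrow> real" where
  "symm'' l i j v = - ((selector_coord i * main_coord j + selector_coord j * main_coord i) / 2 * resZ l v ^ (l + 1)
     + (2 - v 0 - v 1) * (main_coord i * main_coord j / 2 * (real (l + 1) * resZ l v ^ l / (2 * real (l + 2)))))"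

text \<open>Zero exactly at the balanced points; the factor \<open>1 / 3\<close> normalizes it to at
  most 1 on the box, a value attained at the hidden optimum.\<close>

definition imbalance :: "nat \<Rightarrow> (nat \<Rightarrow> real) \<Rightarrow> real" where
  "imbalance l v = 1 / 3 * ((v 0 - v 1)\<^sup>2 + (resP v - resQ l v)\<^sup>2 + (resP v - resR l v)\<^sup>2)"

definition imbalance' :: "nat \<Rightarrow> nat \<Rightarrow> (nat \<Rightarrow> real) \<Rightarrow> real" where
  "imbalance' l i v = 2 / 3 * ((kron i 0 - kron i 1) * (v 0 - v 1)
     + (kron i 3 / real (l + 1) - kron i 2) * (resP v - resQ l v)
     + (kron i 4 / real (l + 2) - kron i 2) * (resP v - resR l v))"

definition imbalance'' :: "nat \<Rightarrow> nat \<Rightarrow> nat \<Rightarrow> (nat \<Rightarrow> real) \<Rightarrow> real" where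
  "imbalance'' l i j v = 2 / 3 *
     ((kron i 0 - kron i 1) * (kron j 0 - kron j 1)
     + (kron i 3 / real (l + 1) - kron i 2) * (kron j 3 / real (l + 1) - kron j 2)
     + (kron i 4 / real (l + 2) - kron i 2) * (kron j 4 / real (l + 2) - kron j 2))"

text \<open>A concave function of the total mass, whose largest value is
  \<open>2 * real (l + 2) + 2\<close>. All its second partials in the coordinates 0 to 4, mixed ones
  included, are -2: a uniform reserve against the errors of the interpolation.\<close>

definition slack :: "nat \<Rightarrow> (nat \<Rightarrow> real) \<Rightarrow> real" where
  "slack l v = (2 * real (l + 2) + 2)\<^sup>2 - (v 0 + v 1 + v 2 + v 3 + v 4)\<^sup>2"

lemma DERIV_res [derivative_intros]:
  "((\<lambda>t. resP (bump v i t)) has_real_derivative - kron i 2) (at 0)"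
  "((\<lambda>t. resQ l (bump v i t)) has_real_derivative - kron i 3 / real (l + 1)) (at 0)"
  "((\<lambda>t. resR l (bump v i t)) has_real_derivative - kron i 4 / real (l + 2)) (at 0)"
  "((\<lambda>t. resZ l (bump v i t)) has_real_derivative - main_coord i / (2 * real (l + 2))) (at 0)"
  unfolding resP_def resQ_def resR_def resZ_def main_coord_def
  by (auto intro!: derivative_eq_intros simp: diff_divide_distrib add_divide_distrib)

lemma DERIV_res_power:
  "((\<lambda>t. resQ l (bump v i t) ^ (l + 1)) has_real_derivative - (kron i 3 * resQ l v ^ l)) (at 0)"
  "((\<lambda>t. resR l (bump v i t) ^ (l + 2)) has_real_derivative - (kron i 4 * resR l v ^ (l + 1))) (at 0)"
  "((\<lambda>t. resZ l (bump v i t) ^ (l + 2)) has_real_derivative - (main_coord i / 2 * resZ l v ^ (l + 1))) (at 0)"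
  by (rule DERIV_cong[OF DERIV_power[OF DERIV_res(2)]], simp,
      rule DERIV_cong[OF DERIV_power[OF DERIV_res(3)]], simp,
      rule DERIV_cong[OF DERIV_power[OF DERIV_res(4)]], simp add: field_simps)

lemma has_partial_skewed: "has_partial (skewed l) i (skewed' l i)"
  unfolding has_partial_def skewed_def skewed'_def
  by (intro allI, (rule DERIV_res_power derivative_eq_intros refl)+,
      simp_all add: algebra_simps add_divide_distrib diff_divide_distrib selector_coord_def)

lemma has_partial_skewed': "has_partial (skewed' l i) j (skewed'' l i j)"
  unfolding has_partial_def skewed'_def skewed''_def
  by (intro allI, (rule DERIV_res_power derivative_eq_intros refl)+,
      simp_all add: algebra_simps add_divide_distrib diff_divide_distrib selector_coord_def)

lemma has_partial_symm: "has_partial (symm l) i (symm' l i)"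
  unfolding has_partial_def symm_def symm'_def
  by (intro allI, (rule DERIV_res_power derivative_eq_intros refl)+,
      simp_all add: algebra_simps add_divide_distrib diff_divide_distrib selector_coord_def)

lemma has_partial_symm': "has_partial (symm' l i) j (symm'' l i j)"
  unfolding has_partial_def symm'_def symm''_def
  by (intro allI, (rule DERIV_res_power derivative_eq_intros refl)+,
      simp_all add: algebra_simps add_divide_distrib diff_divide_distrib selector_coord_def)

lemma has_partial_imbalance: "has_partial (imbalance l) i (imbalance' l i)"
  unfolding has_partial_def imbalance_def imbalance'_def
  by (intro allI, (rule DERIV_res_power derivative_eq_intros refl)+,
      simp add: algebra_simps selector_coord_def)

lemma has_partial_imbalance': "has_partial (imbalance' l i) j (imbalance'' l i j)"
  unfolding has_partial_def imbalance'_def imbalance''_def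
  by (intro allI, (rule DERIV_res_power derivative_eq_intros refl)+,
      simp_all add: algebra_simps add_divide_distrib diff_divide_distrib selector_coord_def)

lemma has_partial_slack:
  "has_partial (slack l) i (\<lambda>v. - 2 * (selector_coord i + main_coord i) * (v 0 + v 1 + v 2 + v 3 + v 4))"
  unfolding has_partial_def slack_def selector_coord_def main_coord_def
  by (intro allI, (rule DERIV_res_power derivative_eq_intros refl)+,
      simp_all add: algebra_simps add_divide_distrib diff_divide_distrib selector_coord_def)

lemma has_partial_slack':
  "has_partial (\<lambda>v. - 2 * (selector_coord i + main_coord i) * (v 0 + v 1 + v 2 + v 3 + v 4)) j
    (\<lambda>v. - 2 * (selector_coord i + main_coord i) * (selector_coord j + main_coord j))"
  unfolding has_partial_def slack_def selector_coord_def main_coord_def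
  by (intro allI, (rule DERIV_res_power derivative_eq_intros refl)+,
      simp_all add: algebra_simps add_divide_distrib diff_divide_distrib selector_coord_def)
text \<open>The weight \<open>\<phi>\<close> stays abstract because the same estimates serve twice:
  \<open>cutoff a\<close> yields the hidden objectives, the constant 0 their symmetrization.\<close>

definition blend :: "nat \<Rightarrow> (real \<Rightarrow> real) \<Rightarrow> real \<Rightarrow> (nat \<Rightarrow> real) \<Rightarrow> real" where
  "blend l \<phi> \<kappa> v = symm l v + \<phi> (imbalance l v) * (skewed l v - symm l v) + \<kappa> * slack l v"

definition blend' where
  "blend' l \<phi> \<phi>' \<kappa> i v = symm' l i v
     + (\<phi>' (imbalance l v) * imbalance' l i v * (skewed l v - symm l v)
        + \<phi> (imbalance l v) * (skewed' l i v - symm' l i v))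
     + \<kappa> * (- 2 * (selector_coord i + main_coord i) * (v 0 + v 1 + v 2 + v 3 + v 4))"

definition blend'' where
  "blend'' l \<phi> \<phi>' \<phi>'' \<kappa> i j v = symm'' l i j v
     + (\<phi>'' (imbalance l v) * imbalance' l j v * imbalance' l i v * (skewed l v - symm l v)
        + \<phi>' (imbalance l v) * imbalance'' l i j v * (skewed l v - symm l v)
        + \<phi>' (imbalance l v) * imbalance' l i v * (skewed' l j v - symm' l j v)
        + \<phi>' (imbalance l v) * imbalance' l j v * (skewed' l i v - symm' l i v)
        + \<phi> (imbalance l v) * (skewed'' l i j v - symm'' l i j v))
     + \<kappa> * (- 2 * (selector_coord i + main_coord i) * (selector_coord j + main_coord j))"

section \<open>Rules for partial derivatives, applied to the interpolation\<close>

lemma has_partial_chain: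
  assumes "has_partial g i g'" "\<And>t. (\<phi> has_real_derivative \<phi>' t) (at t)"
  shows "has_partial (\<lambda>v. \<phi> (g v)) i (\<lambda>v. \<phi>' (g v) * g' v)"
  using assms DERIV_chain2 by (force simp: has_partial_def)

lemma has_partial_add:
  "has_partial f i f' \<Longrightarrow> has_partial g i g' \<Longrightarrow> has_partial (\<lambda>v. f v + g v) i (\<lambda>v. f' v + g' v)"
  by (auto simp: has_partial_def intro: DERIV_add)

lemma has_partial_diff:
  "has_partial f i f' \<Longrightarrow> has_partial g i g' \<Longrightarrow> has_partial (\<lambda>v. f v - g v) i (\<lambda>v. f' v - g' v)"
  by (auto simp: has_partial_def intro: DERIV_diff)

lemma has_partial_cmult:
  "has_partial f i f' \<Longrightarrow> has_partial (\<lambda>v. c * f v) i (\<lambda>v. c * f' v)"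
  by (auto simp: has_partial_def intro: DERIV_cmult)

lemma has_partial_mult:
  "has_partial f i f' \<Longrightarrow> has_partial g i g'
    \<Longrightarrow> has_partial (\<lambda>v. f v * g v) i (\<lambda>v. f' v * g v + f v * g' v)"
  using DERIV_mult by (fastforce simp: has_partial_def mult.commute)

lemma has_partial_blend:
  assumes "\<And>t. (\<phi> has_real_derivative \<phi>' t) (at t)"
  shows "has_partial (blend l \<phi> \<kappa>) i (blend' l \<phi> \<phi>' \<kappa> i)"
  unfolding blend_def blend'_def
  by (intro has_partial_add has_partial_mult has_partial_diff has_partial_cmult
      has_partial_chain[OF _ assms] has_partial_symm has_partial_skewed has_partial_imbalance
      has_partial_slack)

lemma has_partial_blend':
  assumes "\<And>t. (\<phi> has_real_derivative \<phi>' t) (at t)"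
    and "\<And>t. (\<phi>' has_real_derivative \<phi>'' t) (at t)"
  shows "has_partial (blend' l \<phi> \<phi>' \<kappa> i) j (blend'' l \<phi> \<phi>' \<phi>'' \<kappa> i j)"
proof (rule has_partial_cong)
  show "has_partial (blend' l \<phi> \<phi>' \<kappa> i) j (\<lambda>v. symm'' l i j v
     + (((\<phi>'' (imbalance l v) * imbalance' l j v) * imbalance' l i v
            + \<phi>' (imbalance l v) * imbalance'' l i j v) * (skewed l v - symm l v)
        + \<phi>' (imbalance l v) * imbalance' l i v * (skewed' l j v - symm' l j v)
        + (\<phi>' (imbalance l v) * imbalance' l j v * (skewed' l i v - symm' l i v)
        + \<phi> (imbalance l v) * (skewed'' l i j v - symm'' l i j v)))
     + \<kappa> * (- 2 * (selector_coord i + main_coord i) * (selector_coord j + main_coord j)))"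
    unfolding blend'_def
    by (intro has_partial_add has_partial_mult has_partial_diff has_partial_cmult[of _ _ _ \<kappa>]
        has_partial_chain[OF _ assms(1)] has_partial_chain[OF _ assms(2)]
        has_partial_symm has_partial_skewed has_partial_imbalance
        has_partial_symm' has_partial_skewed' has_partial_imbalance' has_partial_slack')
qed (simp add: blend''_def algebra_simps)

subsection \<open>Second-order estimates\<close>

definition in_range :: "nat \<Rightarrow> (nat \<Rightarrow> real) \<Rightarrow> bool" where
  "in_range l v \<longleftrightarrow> (\<forall>i. 0 \<le> v i) \<and> v 0 \<le> 1 \<and> v 1 \<le> 1 \<and> v 2 \<le> 1
     \<and> v 3 \<le> real (l + 1) \<and> v 4 \<le> real (l + 2)"

lemma res_bounds:
  assumes "in_range l v"
  shows "0 \<le> resP v" "resP v \<le> 1" "0 \<le> resQ l v" "resQ l v \<le> 1"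
    "0 \<le> resR l v" "resR l v \<le> 1" "0 \<le> resZ l v" "resZ l v \<le> 1"
proof -
  note b = assms[unfolded in_range_def]
  have "v 2 + v 3 + v 4 \<le> 1 + real (l + 1) + real (l + 2)" using b by linarith
  then have "v 2 + v 3 + v 4 \<le> 2 * real (l + 2)" by simp
  moreover have "0 \<le> v 2 + v 3 + v 4" using b by (simp add: add_nonneg_nonneg)
  ultimately show "0 \<le> resZ l v" "resZ l v \<le> 1"
    by (simp_all add: resZ_def divide_le_eq_1)
qed (use assms in \<open>auto simp: in_range_def resP_def resQ_def resR_def divide_le_eq_1\<close>)

lemma abs_mult_diff_le:
  fixes u w x y :: real
  assumes "\<bar>u\<bar> \<le> 1" "\<bar>y\<bar> \<le> 1"
  shows "\<bar>u * x - w * y\<bar> \<le> \<bar>u - w\<bar> + \<bar>x - y\<bar>"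
proof -
  have "u * x - w * y = u * (x - y) + (u - w) * y" by (simp add: algebra_simps)
  moreover have "\<bar>u * (x - y)\<bar> \<le> \<bar>x - y\<bar>" "\<bar>(u - w) * y\<bar> \<le> \<bar>u - w\<bar>"
    using assms by (auto simp: abs_mult mult_left_le_one_le mult_left_le)
  ultimately show ?thesis by linarith
qed

lemma abs_power_diff_le:
  fixes x y :: real
  assumes "0 \<le> x" "x \<le> 1" "0 \<le> y" "y \<le> 1"
  shows "\<bar>x ^ m - y ^ m\<bar> \<le> real m * \<bar>x - y\<bar>"
  using norm_power_diff[of x y m] assms by simp

lemma power_taylor_error:
  fixes x y :: real
  assumes "0 \<le> x" "x \<le> 1" "0 \<le> y" "y \<le> 1"
  shows "\<bar>x ^ (m + 1) - y ^ (m + 1) - real (m + 1) * y ^ m * (x - y)\<bar> \<le> (real (m + 1))\<^sup>2 * (x - y)\<^sup>2"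
proof (induction m)
  case (Suc m)
  define e where "e = x ^ (m + 1) - y ^ (m + 1) - real (m + 1) * y ^ m * (x - y)"
  \<comment> \<open>The new remainder is the old one times \<open>y\<close> plus a product of two
    first-order differences. The induction closes because \<open>(m + 1) + (m + 1)\<^sup>2\<close>
    is at most \<open>(m + 2)\<^sup>2\<close>.\<close>
  have eq: "x ^ (Suc m + 1) - y ^ (Suc m + 1) - real (Suc m + 1) * y ^ Suc m * (x - y)
      = (x - y) * (x ^ (m + 1) - y ^ (m + 1)) + y * e"
    by (simp add: e_def algebra_simps)
  have "\<bar>(x - y) * (x ^ (m + 1) - y ^ (m + 1))\<bar> \<le> \<bar>x - y\<bar> * (real (m + 1) * \<bar>x - y\<bar>)"
    unfolding abs_mult by (intro mult_left_mono abs_power_diff_le assms) simp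
  also have "\<dots> = real (m + 1) * (x - y)\<^sup>2"
    by (simp add: power2_eq_square)
  finally have 1: "\<bar>(x - y) * (x ^ (m + 1) - y ^ (m + 1))\<bar> \<le> real (m + 1) * (x - y)\<^sup>2" .
  have "\<bar>y * e\<bar> \<le> \<bar>e\<bar>" using assms by (simp add: abs_mult mult_left_le_one_le)
  also have "\<dots> \<le> (real (m + 1))\<^sup>2 * (x - y)\<^sup>2" using Suc.IH by (simp add: e_def)
  finally have 2: "\<bar>y * e\<bar> \<le> (real (m + 1))\<^sup>2 * (x - y)\<^sup>2" .
  have "real (m + 1) + (real (m + 1))\<^sup>2 \<le> (real (Suc m + 1))\<^sup>2"
    by (simp add: power2_eq_square algebra_simps)
  then have "(real (m + 1) + (real (m + 1))\<^sup>2) * (x - y)\<^sup>2 \<le> (real (Suc m + 1))\<^sup>2 * (x - y)\<^sup>2"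
    by (intro mult_right_mono) auto
  with 1 2 show ?case unfolding eq by (simp add: distrib_right)
qed simp

text \<open>First-order companion of \<open>imbalance\<close>: linear errors are measured by it, and
  \<open>deviation_squared_le\<close> turns a product of two of them into a multiple of the
  imbalance.\<close>

definition deviation :: "nat \<Rightarrow> (nat \<Rightarrow> real) \<Rightarrow> real" where
  "deviation l v = \<bar>v 0 - v 1\<bar> + \<bar>resP v - resQ l v\<bar> + \<bar>resP v - resR l v\<bar>"

lemma deviation_nonneg: "0 \<le> deviation l v"
  by (simp add: deviation_def)

lemma deviation_squared_le: "(deviation l v)\<^sup>2 \<le> 9 * imbalance l v"
proof -
  have "(a + b + c)\<^sup>2 \<le> 3 * (a\<^sup>2 + b\<^sup>2 + c\<^sup>2)" for a b c :: real
  proof -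
    have "0 \<le> (a - b)\<^sup>2 + (b - c)\<^sup>2 + (a - c)\<^sup>2" by simp
    then show ?thesis by (simp add: power2_eq_square algebra_simps)
  qed
  from this[of "\<bar>v 0 - v 1\<bar>" "\<bar>resP v - resQ l v\<bar>" "\<bar>resP v - resR l v\<bar>"]
  show ?thesis by (simp add: deviation_def imbalance_def)
qed

lemma imbalance_nonneg: "0 \<le> imbalance l v"
  by (simp add: imbalance_def)

lemma imbalance_le_1:
  assumes "in_range l v"
  shows "imbalance l v \<le> 1"
proof -
  have v: "0 \<le> v 0" "0 \<le> v 1" "v 0 \<le> 1" "v 1 \<le> 1" using assms by (auto simp: in_range_def)
  have "(v 0 - v 1)\<^sup>2 \<le> 1" "(resP v - resQ l v)\<^sup>2 \<le> 1" "(resP v - resR l v)\<^sup>2 \<le> 1"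
    unfolding abs_square_le_1 using res_bounds[OF assms] v by linarith+
  then show ?thesis by (simp add: imbalance_def)
qed

text \<open>\<open>resZ\<close> is the mean of the residuals weighted by the numbers of blocks 1,
  \<open>l + 1\<close> and \<open>l + 2\<close>. In \<open>gap_estimates\<close> this makes the
  first-order terms cancel.\<close>

lemma res_relation:
  "(resP v - resZ l v) + real (l + 1) * (resQ l v - resZ l v) + real (l + 2) * (resR l v - resZ l v) = 0"
proof -
  have "real (l + 1) * resQ l v = real (l + 1) - v 3" "real (l + 2) * resR l v = real (l + 2) - v 4"
    "2 * real (l + 2) * resZ l v = 2 * real (l + 2) - (v 2 + v 3 + v 4)"
    by (simp_all add: resQ_def resR_def resZ_def field_simps)
  then show ?thesis by (simp add: resP_def algebra_simps)
qed

lemma res_deviation: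
  "\<bar>resP v - resZ l v\<bar> \<le> deviation l v" "\<bar>resQ l v - resZ l v\<bar> \<le> 2 * deviation l v"
  "\<bar>resR l v - resZ l v\<bar> \<le> 2 * deviation l v"
proof -
  define N where "N = real (l + 2)"
  have N: "N > 0" "real (l + 1) = N - 1" "1 \<le> N" by (simp_all add: N_def)
  \<comment> \<open>This is \<open>res_relation\<close> with \<open>resQ\<close> and
    \<open>resR\<close> expressed through their differences to \<open>resP\<close>.\<close>
  have "2 * N * (resP v - resZ l v) = (N - 1) * (resP v - resQ l v) + N * (resP v - resR l v)"
    using res_relation[of v l] unfolding N(2) N_def[symmetric] by (simp add: algebra_simps)
  then have "2 * N * \<bar>resP v - resZ l v\<bar> = \<bar>(N - 1) * (resP v - resQ l v) + N * (resP v - resR l v)\<bar>"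
    using N by (metis abs_mult abs_of_nonneg less_eq_real_def mult_2 add_nonneg_nonneg)
  also have "\<dots> \<le> (N - 1) * \<bar>resP v - resQ l v\<bar> + N * \<bar>resP v - resR l v\<bar>"
    by (rule order_trans[OF abs_triangle_ineq]) (use N in \<open>simp add: abs_mult\<close>)
  also have "\<dots> \<le> N * \<bar>resP v - resQ l v\<bar> + N * \<bar>resP v - resR l v\<bar>"
    by (intro add_mono mult_right_mono) auto
  also have "\<dots> \<le> N * deviation l v"
    using N by (simp add: deviation_def distrib_left)
  also have "\<dots> \<le> 2 * N * deviation l v"
    using N deviation_nonneg[of l v] by (simp add: mult_right_mono)
  finally show 1: "\<bar>resP v - resZ l v\<bar> \<le> deviation l v" using N by simp
  have "\<bar>resP v - resQ l v\<bar> \<le> deviation l v" "\<bar>resP v - resR l v\<bar> \<le> deviation l v"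
    by (simp_all add: deviation_def)
  with 1 show "\<bar>resQ l v - resZ l v\<bar> \<le> 2 * deviation l v" "\<bar>resR l v - resZ l v\<bar> \<le> 2 * deviation l v"
    unfolding abs_le_iff by auto
qed

lemma imbalance_partial_le:
  "\<bar>imbalance' l i v\<bar> \<le> deviation l v" "\<bar>imbalance'' l i j v\<bar> \<le> 2"
proof -
  have c: "\<bar>kron i 0 - kron i 1\<bar> \<le> 1" "\<bar>kron i 3 / real (l + 1) - kron i 2\<bar> \<le> 1"
    "\<bar>kron i 4 / real (l + 2) - kron i 2\<bar> \<le> 1" for i
    by (auto simp: kron_def of_bool_def)
  have m: "\<bar>x * y\<bar> \<le> \<bar>y\<bar>" if "\<bar>x\<bar> \<le> 1" for x y :: real
    using that by (simp add: abs_mult mult_left_le_one_le)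
  have s: "\<bar>2 / 3 * (x + y + z)\<bar> \<le> 2 / 3 * (a + b + c)"
    if "\<bar>x\<bar> \<le> a" "\<bar>y\<bar> \<le> b" "\<bar>z\<bar> \<le> c" for x y z a b c :: real
    using that by (intro abs_leI) (auto simp: abs_le_iff field_simps)
  have "\<bar>imbalance' l i v\<bar> \<le> 2 / 3 * deviation l v"
    unfolding imbalance'_def deviation_def by (intro s m c)
  then show "\<bar>imbalance' l i v\<bar> \<le> deviation l v"
    using deviation_nonneg[of l v] by linarith
  have m': "\<bar>x * y\<bar> \<le> 1" if "\<bar>x\<bar> \<le> 1" "\<bar>y\<bar> \<le> 1" for x y :: real
    using m[OF that(1), of y] that(2) by linarith
  have "\<bar>imbalance'' l i j v\<bar> \<le> 2 / 3 * (1 + 1 + 1)"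
    unfolding imbalance''_def by (intro s m' c)
  then show "\<bar>imbalance'' l i j v\<bar> \<le> 2" by simp
qed

text \<open>The two functions and their gradients coincide at balanced points. Replacing the
  residuals by \<open>resZ\<close> and \<open>1 - v 0\<close>, \<open>1 - v 1\<close> by their mean
  therefore costs a linear error in the gradient but only a quadratic one in the value.\<close>

lemma gap_estimates:
  assumes "in_range l v"
  shows "\<bar>resP v * resQ l v ^ (l + 1) - resZ l v ^ (l + 2)\<bar> \<le> 2 * real (l + 2) * deviation l v"
    and "\<bar>resR l v ^ (l + 2) - resZ l v ^ (l + 2)\<bar> \<le> 2 * real (l + 2) * deviation l v"
    and "\<bar>skewed' l i v - symm' l i v\<bar> \<le> 2 * real (l + 2) * deviation l v"
    and "\<bar>skewed l v - symm l v\<bar> \<le> 12 * (real (l + 2))\<^sup>2 * (deviation l v)\<^sup>2"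
proof -
  define r N where "r = deviation l v" and "N = real (l + 2)"
  define P Q R Z where "P = resP v" and "Q = resQ l v" and "R = resR l v" and "Z = resZ l v"
  note defs = r_def N_def P_def Q_def R_def Z_def
  have r: "0 \<le> r" by (simp add: r_def deviation_nonneg)
  have N: "2 \<le> N" "real (l + 1) = N - 1" "real l = N - 2" "real (l + 2) = N" by (simp_all add: N_def)
  have b: "0 \<le> P" "P \<le> 1" "0 \<le> Q" "Q \<le> 1" "0 \<le> R" "R \<le> 1" "0 \<le> Z" "Z \<le> 1"
    using res_bounds[OF assms] by (simp_all add: defs)
  have bp: "\<bar>Q ^ m\<bar> \<le> 1" "\<bar>R ^ m\<bar> \<le> 1" "\<bar>Z ^ m\<bar> \<le> 1" "\<bar>P\<bar> \<le> 1" "\<bar>Z\<bar> \<le> 1" for m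
    using b by (auto simp: power_le_one)
  have d: "\<bar>P - Z\<bar> \<le> r" "\<bar>Q - Z\<bar> \<le> 2 * r" "\<bar>R - Z\<bar> \<le> 2 * r"
    using res_deviation[where v = v and l = l] by (simp_all add: defs)
  have pow: "\<bar>Q ^ m - Z ^ m\<bar> \<le> real m * (2 * r)" "\<bar>R ^ m - Z ^ m\<bar> \<le> real m * (2 * r)" for m
    by (rule order_trans[OF abs_power_diff_le mult_left_mono]; use b d in simp)+
  have prod: "\<bar>P * Q ^ m - Z ^ (m + 1)\<bar> \<le> r + real m * (2 * r)" for m
    using abs_mult_diff_le[OF bp(4) bp(3)[of m], of "Q ^ m" Z] d(1) pow(1)[of m]
    by simp
  have rN: "N * r \<ge> 2 * r" using N r by (simp add: mult_right_mono)
  have Nr: "(N - 1) * (2 * r) = 2 * (N * r) - 2 * r" "(N - 2) * (2 * r) = 2 * (N * r) - 4 * r"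
    by (simp_all add: algebra_simps)
  show 0: "\<bar>resP v * resQ l v ^ (l + 1) - resZ l v ^ (l + 2)\<bar> \<le> 2 * real (l + 2) * deviation l v"
    using prod[of "l + 1"] r unfolding N Nr by (simp add: defs[symmetric])
  show 1: "\<bar>resR l v ^ (l + 2) - resZ l v ^ (l + 2)\<bar> \<le> 2 * real (l + 2) * deviation l v"
    using pow(2)[of "l + 2"] unfolding N by (simp add: defs[symmetric])
  define h where "h = (2 - v 0 - v 1) / 2"
  have v: "0 \<le> v 0" "0 \<le> v 1" "v 0 \<le> 1" "v 1 \<le> 1" using assms by (auto simp: in_range_def)
  have "\<bar>v 0 - v 1\<bar> \<le> r" by (simp add: r_def deviation_def)
  with v have h: "\<bar>(1 - v 0) - h\<bar> \<le> r" "\<bar>(1 - v 1) - h\<bar> \<le> r" "\<bar>h\<bar> \<le> 1"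
    unfolding h_def abs_le_iff by (auto simp: field_simps)
  have u: "\<bar>1 - v 0\<bar> \<le> 1" "\<bar>1 - v 1\<bar> \<le> 1" using v by auto
  have E2: "\<bar>(1 - v 0) * Q ^ (l + 1) - h * Z ^ (l + 1)\<bar> \<le> 2 * N * r"
    using abs_mult_diff_le[OF u(1) bp(3)[of "l + 1"], of "Q ^ (l + 1)" h] h(1) pow(1)[of "l + 1"] r
    unfolding N Nr by linarith
  have E3: "\<bar>(1 - v 0) * (P * Q ^ l) - h * Z ^ (l + 1)\<bar> \<le> 2 * N * r"
    using abs_mult_diff_le[OF u(1) bp(3)[of "l + 1"], of "P * Q ^ l" h] h(1) prod[of l] r
    unfolding N Nr by linarith
  have E4: "\<bar>(1 - v 1) * R ^ (l + 1) - h * Z ^ (l + 1)\<bar> \<le> 2 * N * r"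
    using abs_mult_diff_le[OF u(2) bp(3)[of "l + 1"], of "R ^ (l + 1)" h] h(2) pow(2)[of "l + 1"] r
    unfolding N Nr by linarith
  consider "i = 0" | "i = 1" | "i = 2" | "i = 3" | "i = 4" | "i > 4" by linarith
  then show "\<bar>skewed' l i v - symm' l i v\<bar> \<le> 2 * real (l + 2) * deviation l v"
  proof cases
    case 1
    then show ?thesis using 0 by (simp add: skewed'_def symm'_def selector_coord_def main_coord_def kron_def)
  next
    case 2
    then show ?thesis using 1 by (simp add: skewed'_def symm'_def selector_coord_def main_coord_def kron_def)
  next
    case 3
    then show ?thesis using E2
      by (simp add: skewed'_def symm'_def selector_coord_def main_coord_def kron_def defs h_def)
  next
    case 4
    then show ?thesis using E3
      by (simp add: skewed'_def symm'_def selector_coord_def main_coord_def kron_def defs h_def)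
  next
    case 5
    then show ?thesis using E4
      by (simp add: skewed'_def symm'_def selector_coord_def main_coord_def kron_def defs h_def)
  next
    case 6
    then show ?thesis using deviation_nonneg[of l v]
      by (simp add: skewed'_def symm'_def selector_coord_def main_coord_def kron_def)
  qed
  define eQ eR where
    "eQ = Q ^ (l + 1) - Z ^ (l + 1) - real (l + 1) * Z ^ l * (Q - Z)" and
    "eR = R ^ (l + 2) - Z ^ (l + 2) - real (l + 2) * Z ^ (l + 1) * (R - Z)"
  have sq: "(Q - Z)\<^sup>2 \<le> 4 * r\<^sup>2" "(R - Z)\<^sup>2 \<le> 4 * r\<^sup>2"
    using power_mono[OF d(2), of 2] power_mono[OF d(3), of 2] by (simp_all add: power_mult_distrib)
  have "\<bar>eQ\<bar> \<le> (N - 1)\<^sup>2 * (Q - Z)\<^sup>2"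
    using power_taylor_error[of Q Z l] b unfolding eQ_def N by simp
  also have "\<dots> \<le> N\<^sup>2 * (4 * r\<^sup>2)"
    using N by (intro mult_mono sq power_mono) auto
  finally have eQ: "\<bar>eQ\<bar> \<le> 4 * (N\<^sup>2 * r\<^sup>2)" by simp
  have "\<bar>eR\<bar> \<le> N\<^sup>2 * (R - Z)\<^sup>2"
    using power_taylor_error[of R Z "l + 1"] b unfolding eR_def by (simp add: N_def algebra_simps)
  also have "\<dots> \<le> N\<^sup>2 * (4 * r\<^sup>2)"
    using N by (intro mult_mono sq power_mono) auto
  finally have eR: "\<bar>eR\<bar> \<le> 4 * (N\<^sup>2 * r\<^sup>2)" by simp
  have "\<bar>Z * eQ\<bar> \<le> \<bar>eQ\<bar>" using b by (simp add: abs_mult mult_left_le_one_le)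
  with eQ have ZeQ: "\<bar>Z * eQ\<bar> \<le> 4 * (N\<^sup>2 * r\<^sup>2)" by linarith
  have "\<bar>(P - Z) * (Q ^ (l + 1) - Z ^ (l + 1))\<bar> \<le> r * (N * (2 * r))"
    unfolding abs_mult
    by (intro mult_mono d order_trans[OF pow(1)]) (use r N in auto)
  also have "\<dots> = 2 * (N * r\<^sup>2)" by (simp add: power2_eq_square)
  finally have cross: "\<bar>(P - Z) * (Q ^ (l + 1) - Z ^ (l + 1))\<bar> \<le> 2 * (N * r\<^sup>2)" .
  have lin: "(P - Z) + real (l + 1) * (Q - Z) + real (l + 2) * (R - Z) = 0"
    using res_relation[of v l] by (simp add: defs)
  \<comment> \<open>The last bracket is zero by \<open>lin\<close>, which removes the linear part;
    products of two small factors and the Taylor remainders are left.\<close>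
  have "P * Q ^ (l + 1) + R ^ (l + 2) - 2 * Z ^ (l + 2) =
      (P - Z) * (Q ^ (l + 1) - Z ^ (l + 1)) + Z * eQ + eR
      + Z ^ (l + 1) * ((P - Z) + real (l + 1) * (Q - Z) + real (l + 2) * (R - Z))"
    by (simp add: eQ_def eR_def algebra_simps)
  then have "\<bar>P * Q ^ (l + 1) + R ^ (l + 2) - 2 * Z ^ (l + 2)\<bar> \<le> 8 * (N\<^sup>2 * r\<^sup>2) + 2 * (N * r\<^sup>2)"
    using cross ZeQ eR unfolding lin by linarith
  moreover have "\<bar>h * (P * Q ^ (l + 1) + R ^ (l + 2) - 2 * Z ^ (l + 2))\<bar>
      \<le> \<bar>P * Q ^ (l + 1) + R ^ (l + 2) - 2 * Z ^ (l + 2)\<bar>"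
    using h(3) by (simp add: abs_mult mult_left_le_one_le)
  moreover have "\<bar>(v 0 - v 1) / 2 * (P * Q ^ (l + 1) - R ^ (l + 2))\<bar> \<le> (r / 2) * (4 * N * r)"
    unfolding abs_mult
  proof (intro mult_mono)
    show "\<bar>(v 0 - v 1) / 2\<bar> \<le> r / 2" by (simp add: r_def deviation_def)
    show "\<bar>P * Q ^ (l + 1) - R ^ (l + 2)\<bar> \<le> 4 * N * r"
      using 0 1 unfolding defs[symmetric] by linarith
  qed (use r in auto)
  moreover have "(r / 2) * (4 * N * r) = 2 * (N * r\<^sup>2)" by (simp add: power2_eq_square)
  \<comment> \<open>Here \<open>1 - v 0\<close> and \<open>1 - v 1\<close> are written as
    \<open>h\<close> minus and plus \<open>(v 0 - v 1) / 2\<close>. The antisymmetric part is a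
    product of two first-order differences, the symmetric part was just seen to be quadratic;
    together \<open>2 + 8 + 2\<close> gives the 12.\<close>
  moreover have "skewed l v - symm l v = (v 0 - v 1) / 2 * (P * Q ^ (l + 1) - R ^ (l + 2))
      - h * (P * Q ^ (l + 1) + R ^ (l + 2) - 2 * Z ^ (l + 2))"
    unfolding skewed_def symm_def defs[symmetric] h_def by (simp add: field_simps)
  moreover have "N * r\<^sup>2 \<le> N\<^sup>2 * r\<^sup>2"
    using N by (intro mult_right_mono) (auto simp: power2_eq_square)
  ultimately have "\<bar>skewed l v - symm l v\<bar> \<le> 12 * (N\<^sup>2 * r\<^sup>2)" by linarith
  then show "\<bar>skewed l v - symm l v\<bar> \<le> 12 * (real (l + 2))\<^sup>2 * (deviation l v)\<^sup>2"
    by (simp add: defs)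
qed

lemma skewed''_nonpos: "in_range l v \<Longrightarrow> skewed'' l i j v \<le> 0"
  using res_bounds[of l v]
  unfolding skewed''_def neg_le_0_iff_le
  by (intro add_nonneg_nonneg mult_nonneg_nonneg divide_nonneg_nonneg zero_le_power)
    (auto simp: in_range_def kron_def)

lemma symm''_nonpos: "in_range l v \<Longrightarrow> symm'' l i j v \<le> 0"
  using res_bounds[of l v]
  unfolding symm''_def neg_le_0_iff_le selector_coord_def main_coord_def
  by (intro add_nonneg_nonneg mult_nonneg_nonneg divide_nonneg_nonneg zero_le_power)
    (auto simp: in_range_def kron_def)

text \<open>Each term with \<open>\<phi>'\<close> or \<open>\<phi>''\<close> carries enough factors
  of the deviation to be a multiple of \<open>D * \<bar>\<phi>' D\<bar>\<close> or
  \<open>D\<^sup>2 * \<bar>\<phi>'' D\<bar>\<close>, hence of \<open>a\<close>. The terms without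
  them form a convex combination of nonpositive second derivatives, and the slack contributes
  \<open>- 2 * \<kappa>\<close>.\<close>

lemma blend''_nonpos:
  assumes in_range: "in_range l v" and ij: "i \<le> 4" "j \<le> 4" and a: "0 \<le> a"
    and phi: "0 \<le> \<phi> (imbalance l v)" "\<phi> (imbalance l v) \<le> 1"
      "imbalance l v * \<bar>\<phi>' (imbalance l v)\<bar> \<le> 3 * a"
      "(imbalance l v)\<^sup>2 * \<bar>\<phi>'' (imbalance l v)\<bar> \<le> 9 * a"
    and kappa: "6000 * a * (real (l + 2))\<^sup>2 \<le> \<kappa>"
  shows "blend'' l \<phi> \<phi>' \<phi>'' \<kappa> i j v \<le> 0"
proof -
  define D r c where "D = imbalance l v" and "r = deviation l v" and "c = 12 * (real (l + 2))\<^sup>2"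
  define E where "E = skewed l v - symm l v"
  have D: "0 \<le> D" and r: "0 \<le> r" and rD: "r\<^sup>2 \<le> 9 * D" and c: "0 \<le> c"
    by (simp_all add: D_def r_def c_def deviation_squared_le deviation_nonneg imbalance_nonneg)
  have E: "\<bar>E\<bar> \<le> c * r\<^sup>2" using gap_estimates(4)[OF in_range] by (simp add: E_def c_def r_def)
  have D1: "\<bar>imbalance' l i v\<bar> \<le> r" "\<bar>imbalance'' l i j v\<bar> \<le> 2" for i j
    using imbalance_partial_le by (auto simp: r_def)
  have E1: "\<bar>skewed' l i v - symm' l i v\<bar> \<le> c * r" for i
  proof (rule order_trans[OF gap_estimates(3)[OF in_range]])
    have "2 * real (l + 2) \<le> c" by (simp add: c_def power2_eq_square algebra_simps)
    then show "2 * real (l + 2) * deviation l v \<le> c * r"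
      using r by (simp add: r_def mult_right_mono)
  qed
  have cr: "c * r\<^sup>2 \<le> c * (9 * D)" using c rD by (intro mult_left_mono)
  have r4: "r\<^sup>2 * (c * r\<^sup>2) \<le> 81 * c * D\<^sup>2"
  proof -
    have "r\<^sup>2 * (c * r\<^sup>2) \<le> (9 * D) * (c * (9 * D))"
      by (intro mult_mono cr rD) (use c D in auto)
    then show ?thesis by (simp add: power2_eq_square mult_ac)
  qed
  have "\<bar>\<phi>'' D * imbalance' l j v * imbalance' l i v * E\<bar> = \<bar>\<phi>'' D\<bar> * ((\<bar>imbalance' l j v\<bar> * \<bar>imbalance' l i v\<bar>) * \<bar>E\<bar>)"
    by (simp add: abs_mult)
  also have "\<dots> \<le> \<bar>\<phi>'' D\<bar> * ((r * r) * (c * r\<^sup>2))"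
    by (intro mult_left_mono mult_mono D1 E) (use r c in auto)
  also have "\<dots> \<le> \<bar>\<phi>'' D\<bar> * (81 * c * D\<^sup>2)"
    using r4 by (intro mult_left_mono) (simp_all add: power2_eq_square)
  also have "\<dots> = 81 * c * (D\<^sup>2 * \<bar>\<phi>'' D\<bar>)" by simp
  also have "\<dots> \<le> 81 * c * (9 * a)"
    using phi(4) c by (intro mult_left_mono) (simp_all add: D_def)
  finally have t1: "\<bar>\<phi>'' D * imbalance' l j v * imbalance' l i v * E\<bar> \<le> 729 * (a * c)" by (simp add: mult.commute)
  have small: "\<bar>\<phi>' D * x * y\<bar> \<le> 54 * (a * c)" if "\<bar>x * y\<bar> \<le> 2 * (c * r\<^sup>2)" for x y
  proof -
    have "\<bar>\<phi>' D * x * y\<bar> = \<bar>\<phi>' D\<bar> * \<bar>x * y\<bar>" by (simp add: abs_mult)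
    also have "\<dots> \<le> \<bar>\<phi>' D\<bar> * (2 * (c * (9 * D)))"
      using that cr by (intro mult_left_mono) auto
    also have "\<dots> = 18 * c * (D * \<bar>\<phi>' D\<bar>)" by simp
    also have "\<dots> \<le> 18 * c * (3 * a)"
      using phi(3) c by (intro mult_left_mono) (simp_all add: D_def)
    finally show ?thesis by (simp add: mult.commute)
  qed
  have t2: "\<bar>\<phi>' D * imbalance'' l i j v * E\<bar> \<le> 54 * (a * c)"
    by (rule small) (unfold abs_mult, intro mult_mono D1 E, auto)
  have t3: "\<bar>\<phi>' D * imbalance' l i v * (skewed' l j v - symm' l j v)\<bar> \<le> 54 * (a * c)" for i j
  proof (rule small)
    have "\<bar>imbalance' l i v * (skewed' l j v - symm' l j v)\<bar> \<le> r * (c * r)"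
      unfolding abs_mult by (intro mult_mono D1 E1) (use r in auto)
    also have "\<dots> \<le> 2 * (c * r\<^sup>2)" using c by (simp add: power2_eq_square)
    finally show "\<bar>imbalance' l i v * (skewed' l j v - symm' l j v)\<bar> \<le> 2 * (c * r\<^sup>2)" .
  qed
  have conv: "symm'' l i j v + \<phi> D * (skewed'' l i j v - symm'' l i j v) \<le> 0"
  proof -
    have "(1 - \<phi> D) * symm'' l i j v \<le> 0" "\<phi> D * skewed'' l i j v \<le> 0"
      using phi symm''_nonpos[OF in_range] skewed''_nonpos[OF in_range] by (auto simp: D_def mult_le_0_iff)
    then show ?thesis by (simp add: algebra_simps)
  qed
  have "selector_coord i + main_coord i = 1" "selector_coord j + main_coord j = 1"
    using ij by (auto simp: selector_coord_def main_coord_def kron_def numeral_eq_Suc le_Suc_eq)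
  then have sl: "\<kappa> * (- 2 * (selector_coord i + main_coord i) * (selector_coord j + main_coord j)) = - 2 * \<kappa>" by simp
  have "2 * \<kappa> \<ge> 1000 * (a * c)" using kappa by (simp add: c_def)
  moreover have "0 \<le> a * c" using a c by simp
  ultimately show ?thesis
    using t1 t2 t3[of i j] t3[of j i] conv unfolding blend''_def sl D_def[symmetric] E_def[symmetric]
    by linarith
qed

text \<open>The last bound serves at the hidden optimum, where the weight is 1; the upper bound
  limits what an algorithm can gain from lucky queries.\<close>

lemma blend_bounds:
  assumes "in_range l v" "0 \<le> \<phi> (imbalance l v)" "\<phi> (imbalance l v) \<le> 1" "0 \<le> \<kappa>"
  shows "0 \<le> blend l \<phi> \<kappa> v" "blend l \<phi> \<kappa> v \<le> 2 + \<kappa> * (2 * real (l + 2) + 2)\<^sup>2"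
    "\<phi> (imbalance l v) * skewed l v \<le> blend l \<phi> \<kappa> v"
proof -
  note r = res_bounds[OF assms(1)] and b = assms(1)[unfolded in_range_def]
  have pq: "0 \<le> resP v * resQ l v ^ (l + 1)" "resP v * resQ l v ^ (l + 1) \<le> 1"
    "0 \<le> resR l v ^ (l + 2)" "resR l v ^ (l + 2) \<le> 1" "0 \<le> resZ l v ^ (l + 2)" "resZ l v ^ (l + 2) \<le> 1"
    using r by (auto intro!: mult_le_one power_le_one simp del: power_Suc)
  have sk: "0 \<le> skewed l v" "skewed l v \<le> 1 * 1 + 1 * 1"
    unfolding skewed_def using pq b by (intro add_nonneg_nonneg mult_nonneg_nonneg add_mono mult_mono; simp)+
  have "0 \<le> v 0" "0 \<le> v 1" "v 0 \<le> 1" "v 1 \<le> 1" using b by auto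
  then have "0 \<le> 2 - v 0 - v 1" "2 - v 0 - v 1 \<le> 2" by linarith+
  then have sy: "0 \<le> symm l v" "symm l v \<le> 2 * 1"
    unfolding symm_def using pq by (intro mult_nonneg_nonneg mult_mono; simp)+
  have "v 0 + v 1 + v 2 + v 3 + v 4 \<le> 1 + 1 + 1 + real (l + 1) + real (l + 2)"
    using b by (intro add_mono) auto
  then have "v 0 + v 1 + v 2 + v 3 + v 4 \<le> 2 * real (l + 2) + 2" by simp
  moreover have "0 \<le> v 0 + v 1 + v 2 + v 3 + v 4" using b by (simp add: add_nonneg_nonneg)
  ultimately have "(v 0 + v 1 + v 2 + v 3 + v 4)\<^sup>2 \<le> (2 * real (l + 2) + 2)\<^sup>2"
    by (intro power_mono)
  then have "0 \<le> slack l v" "slack l v \<le> (2 * real (l + 2) + 2)\<^sup>2" by (auto simp: slack_def)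
  then have sl: "0 \<le> \<kappa> * slack l v" "\<kappa> * slack l v \<le> \<kappa> * (2 * real (l + 2) + 2)\<^sup>2"
    using assms(4) by (auto intro: mult_left_mono)
  define p where "p = \<phi> (imbalance l v)"
  have p: "0 \<le> p" "p \<le> 1" using assms by (simp_all add: p_def)
  have eq: "blend l \<phi> \<kappa> v = (1 - p) * symm l v + p * skewed l v + \<kappa> * slack l v"
    by (simp add: blend_def p_def algebra_simps)
  have m: "0 \<le> (1 - p) * symm l v" "0 \<le> p * skewed l v" using p sk sy by auto
  show "0 \<le> blend l \<phi> \<kappa> v" "\<phi> (imbalance l v) * skewed l v \<le> blend l \<phi> \<kappa> v"
    unfolding eq p_def[symmetric] using m sl by auto
  have "(1 - p) * symm l v \<le> (1 - p) * 2" "p * skewed l v \<le> p * 2"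
    using p sk sy by (intro mult_left_mono; simp)+
  then show "blend l \<phi> \<kappa> v \<le> 2 + \<kappa> * (2 * real (l + 2) + 2)\<^sup>2"
    unfolding eq using sl by (simp add: algebra_simps)
qed

subsection \<open>From second derivatives to submodularity\<close>

text \<open>The local inequality is summed along chains: \<open>marg\<close> adds the elements of
  \<open>T - S\<close> one by one, \<open>main\<close> those of \<open>S - T\<close>, starting from
  the intersection.\<close>

lemma submodular_onI_local:
  assumes fin: "finite X"
    and loc: "\<And>S x y. \<lbrakk>S \<subseteq> X; x \<in> X - S; y \<in> X - S; x \<noteq> y\<rbrakk>
      \<Longrightarrow> f (insert y (insert x S)) + f S \<le> f (insert x S) + f (insert y S)"
  shows "submodular_on X f"
proof -
  have marg: "f (insert x (A \<union> C)) + f A \<le> f (insert x A) + f (A \<union> C)"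
    if "finite C" "A \<union> C \<subseteq> X" "A \<inter> C = {}" "x \<in> X - (A \<union> C)" for A C x
    using that
  proof (induction C rule: finite_induct)
    case (insert c C)
    have "f (insert x (insert c (A \<union> C))) + f (A \<union> C) \<le> f (insert c (A \<union> C)) + f (insert x (A \<union> C))"
      using insert.prems insert.hyps by (intro loc) auto
    moreover have "f (insert x (A \<union> C)) + f A \<le> f (insert x A) + f (A \<union> C)"
      using insert by auto
    ultimately show ?case by simp
  qed simp
  have main: "f (A \<union> C \<union> B) + f A \<le> f (A \<union> B) + f (A \<union> C)"
    if "finite B" "A \<union> C \<union> B \<subseteq> X" "A \<inter> C = {}" "B \<inter> (A \<union> C) = {}" for A B C
    using that
  proof (induction B rule: finite_induct)
    case (insert b B)
    have "finite C" using insert.prems fin by (meson finite_subset le_sup_iff)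
    then have "f (insert b (A \<union> B \<union> C)) + f (A \<union> B) \<le> f (insert b (A \<union> B)) + f (A \<union> B \<union> C)"
      using insert by (intro marg) auto
    moreover have "f (A \<union> C \<union> B) + f A \<le> f (A \<union> B) + f (A \<union> C)"
      using insert by auto
    ultimately show ?case by (simp add: Un_ac)
  qed simp
  have "f (S \<inter> T \<union> (T - S) \<union> (S - T)) + f (S \<inter> T) \<le> f (S \<inter> T \<union> (S - T)) + f (S \<inter> T \<union> (T - S))"
    if "S \<subseteq> X" "T \<subseteq> X" for S T
    using that finite_subset[OF _ fin] by (intro main) auto
  moreover have "S \<inter> T \<union> (T - S) \<union> (S - T) = S \<union> T" "S \<inter> T \<union> (S - T) = S"
    "S \<inter> T \<union> (T - S) = T" for S T :: "'a set" by auto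
  ultimately show ?thesis by (simp add: submodular_on_def)
qed

definition profile :: "('a \<Rightarrow> nat) \<Rightarrow> nat \<Rightarrow> 'a set \<Rightarrow> nat \<Rightarrow> real" where
  "profile cl n S i = real (card {e \<in> S. cl e = i}) / real n"

lemma profile_insert:
  assumes "finite S" "e \<notin> S"
  shows "profile cl n (insert e S) = bump (profile cl n S) (cl e) (1 / real n)"
proof
  fix i
  have "{x \<in> insert e S. cl x = i} = (if cl e = i then insert e {x \<in> S. cl x = i} else {x \<in> S. cl x = i})"
    by auto
  then show "profile cl n (insert e S) i = bump (profile cl n S) (cl e) (1 / real n) i"
    using assms by (simp add: profile_def bump_apply add_divide_distrib)
qed

lemma submodular_on_blend:
  assumes X: "finite X" and in_range: "\<And>S. S \<subseteq> X \<Longrightarrow> in_range l (profile cl n S)"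
    and cl: "\<And>e. e \<in> X \<Longrightarrow> cl e \<le> 4" and a: "0 \<le> a"
    and phi: "\<And>t. (\<phi> has_real_derivative \<phi>' t) (at t)" "\<And>t. (\<phi>' has_real_derivative \<phi>'' t) (at t)"
      "\<And>t. \<lbrakk>0 \<le> t; t \<le> 1\<rbrakk> \<Longrightarrow> 0 \<le> \<phi> t \<and> \<phi> t \<le> 1 \<and> t * \<bar>\<phi>' t\<bar> \<le> 3 * a \<and> t\<^sup>2 * \<bar>\<phi>'' t\<bar> \<le> 9 * a"
    and kappa: "6000 * a * (real (l + 2))\<^sup>2 \<le> \<kappa>"
  shows "submodular_on X (\<lambda>S. blend l \<phi> \<kappa> (profile cl n S))"
proof (rule submodular_onI_local[OF X])
  fix S x y assume S: "S \<subseteq> X" "x \<in> X - S" "y \<in> X - S" "x \<noteq> y"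
  define v h where "v = profile cl n S" and "h = 1 / real n"
  have fin: "finite S" using S X finite_subset by blast
  have px: "profile cl n (insert x S) = bump v (cl x) h" "profile cl n (insert y S) = bump v (cl y) h"
    "profile cl n (insert y (insert x S)) = bump (bump v (cl x) h) (cl y) h"
    using S fin by (simp_all add: profile_insert v_def h_def)
  have b0: "in_range l v" using in_range[OF S(1)] by (simp add: v_def)
  have b1: "in_range l (bump (bump v (cl x) h) (cl y) h)"
    using in_range[of "insert y (insert x S)"] S px by auto
  \<comment> \<open>Every coordinate lies between those of the two extreme profiles, so the whole
    square stays in the box.\<close>
  have "in_range l (bump (bump v (cl x) s) (cl y) t)" if "0 \<le> s" "s \<le> h" "0 \<le> t" "t \<le> h" for s t
  proof -
    have "v i \<le> bump (bump v (cl x) s) (cl y) t i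
        \<and> bump (bump v (cl x) s) (cl y) t i \<le> bump (bump v (cl x) h) (cl y) h i" for i
      using that by (auto simp: bump_apply)
    then show ?thesis using b0 b1 unfolding in_range_def by (meson order_trans)
  qed
  then have "blend l \<phi> \<kappa> (bump (bump v (cl x) h) (cl y) h) + blend l \<phi> \<kappa> v
      \<le> blend l \<phi> \<kappa> (bump v (cl x) h) + blend l \<phi> \<kappa> (bump v (cl y) h)"
    using S cl a kappa imbalance_nonneg imbalance_le_1 phi(3)
    by (intro mixed_difference_nonpos[OF has_partial_blend[OF phi(1)] has_partial_blend'[OF phi(1,2)]]
        blend''_nonpos[where a = a]) (auto simp: h_def)
  then show "blend l \<phi> \<kappa> (profile cl n (insert y (insert x S))) + blend l \<phi> \<kappa> (profile cl n S)
      \<le> blend l \<phi> \<kappa> (profile cl n (insert x S)) + blend l \<phi> \<kappa> (profile cl n (insert y S))"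
    by (simp add: px v_def)
qed

subsection \<open>Hidden partitions\<close>

text \<open>The ground set consists of \<open>n\<close> groups of \<open>2 * l + 6\<close> elements. In each group the first two
  positions belong to the selector block, the others to the main block, and the classes are
  rotated by a hidden amount, so that the groups are independent.\<close>

definition role :: "nat \<Rightarrow> nat \<Rightarrow> nat \<Rightarrow> nat" where
  "role l r j = (let s = (j + r) mod (2 * l + 4) in
     if j < 2 then s mod 2 else if s = 0 then 2 else if s < l + 2 then 3 else 4)"

definition hidden_class :: "nat \<Rightarrow> (nat \<Rightarrow> nat) \<Rightarrow> nat \<Rightarrow> nat" where
  "hidden_class l \<rho> e = role l (\<rho> (e div (2 * l + 6))) (e mod (2 * l + 6))"

definition selector :: "nat \<Rightarrow> nat set" where
  "selector l = {e. e mod (2 * l + 6) < 2}"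

lemma sum_rotate:
  fixes h :: "nat \<Rightarrow> 'b::comm_monoid_add"
  assumes "0 < N"
  shows "(\<Sum>j<N. h ((j + r) mod N)) = (\<Sum>s<N. h s)"
proof (rule sum.reindex_bij_betw[of "\<lambda>j. (j + r) mod N"])
  have inj: "inj_on (\<lambda>j. (j + r) mod N) {..<N}"
  proof (rule inj_onI)
    fix x y assume xy: "x \<in> {..<N}" "y \<in> {..<N}" "(x + r) mod N = (y + r) mod N"
    then obtain p q where "(x + r) + N * p = (y + r) + N * q" by (auto simp: nat_mod_eq_iff)
    then have "x + N * p = y + N * q" by simp
    then have "x mod N = y mod N" by (metis nat_mod_eq_iff)
    then show "x = y" using xy by simp
  qed
  moreover have "(\<lambda>j. (j + r) mod N) ` {..<N} \<subseteq> {..<N}" using assms by auto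
  ultimately show "bij_betw (\<lambda>j. (j + r) mod N) {..<N} {..<N}"
    by (simp add: bij_betw_def endo_inj_surj)
qed

lemma sum_groups:
  fixes h :: "nat \<Rightarrow> 'b::comm_monoid_add"
  shows "(\<Sum>e<n * M. h e) = (\<Sum>g<n. \<Sum>j<M. h (g * M + j))"
proof -
  have "(\<Sum>e<n * M. h e) = (\<Sum>g<n. sum h {g * M..<g * M + M})"
    by (rule sum.nat_group[symmetric])
  also have "\<dots> = (\<Sum>g<n. \<Sum>j<M. h (g * M + j))"
    by (simp add: sum.atLeastLessThan_shift_0[of h] atLeast0LessThan comp_def)
  finally show ?thesis .
qed

lemma sum_residue_classes:
  fixes y :: "nat \<Rightarrow> real"
  shows "(\<Sum>s<2 * l + 4. y (if s = 0 then 2 else if s < l + 2 then 3 else 4))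
    = y 2 + real (l + 1) * y 3 + real (l + 2) * y 4"
proof -
  have "{..<2 * l + 4} = insert 0 ({1..<l + 2} \<union> {l + 2..<2 * l + 4})" by auto
  then have "(\<Sum>s<2 * l + 4. y (if s = 0 then 2 else if s < l + 2 then 3 else 4))
      = y 2 + ((\<Sum>s\<in>{1..<l + 2}. y 3) + (\<Sum>s\<in>{l + 2..<2 * l + 4}. y 4))"
    by (simp add: sum.union_disjoint)
  then show ?thesis by (simp add: algebra_simps)
qed

text \<open>Every group has the same composition under every rotation: as \<open>2 * l + 4\<close>
  is even, the two selector positions keep opposite parities, and the main positions run through
  each residue once.\<close>

lemma sum_role_positions:
  fixes y :: "nat \<Rightarrow> real"
  shows "(\<Sum>j<2 * l + 6. y (role l r j)) = y 0 + y 1 + y 2 + real (l + 1) * y 3 + real (l + 2) * y 4"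
proof -
  have "(\<Sum>j<2 * l + 6. y (role l r j))
      = (\<Sum>j<2. y (role l r j)) + (\<Sum>j<2 * l + 4. y (role l r (j + 2)))"
    using sum.atLeastLessThan_concat[of 0 2 "2 * l + 6" "\<lambda>j. y (role l r j)"]
      sum.shift_bounds_nat_ivl[of "\<lambda>j. y (role l r j)" 0 2 "2 * l + 4"]
    by (simp add: atLeast0LessThan numeral_eq_Suc)
  moreover have "(\<Sum>j<2. y (role l r j)) = y 0 + y 1"
  proof -
    have "(j + r) mod (2 * l + 4) mod 2 = (j + r) mod 2" for j
      by (rule mod_mod_cancel) simp
    then have "(\<Sum>j<2. y (role l r j)) = (\<Sum>j<2. y ((j + r) mod 2))"
      by (simp add: role_def Let_def)
    also have "\<dots> = y 0 + y 1" by (subst sum_rotate) (simp_all add: numeral_2_eq_2)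
    finally show ?thesis .
  qed
  moreover have "(\<Sum>j<2 * l + 4. y (role l r (j + 2))) =
      (\<Sum>j<2 * l + 4. (\<lambda>s. y (if s = 0 then 2 else if s < l + 2 then 3 else 4)) ((j + (r + 2)) mod (2 * l + 4)))"
    by (simp add: role_def Let_def add_ac cong: if_cong)
  ultimately show ?thesis by (subst (asm) sum_rotate) (simp_all add: sum_residue_classes)
qed

text \<open>The dual count: at a fixed position, a uniformly random rotation hits the classes of the
  selector or main block in proportion to their sizes. Functionals that measure imbalance thus have
  mean 0.\<close>

lemma sum_role_rotations:
  fixes y :: "nat \<Rightarrow> real"
  shows "(\<Sum>r<2 * l + 4. y (role l r j)) =
    (if j < 2 then real (l + 2) * (y 0 + y 1) else y 2 + real (l + 1) * y 3 + real (l + 2) * y 4)"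
proof (cases "j < 2")
  case True
  have "(\<Sum>s<2 * m. y (s mod 2)) = real m * (y 0 + y 1)" for m
    by (induction m) (simp_all add: algebra_simps mod_Suc)
  moreover have "2 * l + 4 = 2 * (l + 2)" by simp
  ultimately have "(\<Sum>s<2 * l + 4. y (s mod 2)) = real (l + 2) * (y 0 + y 1)" by metis
  then show ?thesis
    using True sum_rotate[of "2 * l + 4" "\<lambda>s. y (s mod 2)" j] by (simp add: role_def Let_def add_ac)
next
  case False
  then show ?thesis
    using sum_rotate[of "2 * l + 4" "\<lambda>s. y (if s = 0 then 2 else if s < l + 2 then 3 else 4)" j]
    by (simp add: role_def Let_def add.commute[of j] sum_residue_classes)
qed

subsection \<open>Concentration\<close>

lemma exp_le_quadratic:
  fixes x :: real
  assumes "\<bar>x\<bar> \<le> 1"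
  shows "exp x \<le> 1 + x + x\<^sup>2"
proof (cases "0 \<le> x")
  case True
  then show ?thesis using assms exp_bound by simp
next
  case False
  define z where "z = - x"
  have z: "0 \<le> z" "z \<le> 1" using False assms by (auto simp: z_def)
  \<comment> \<open>In this product the terms of degree 1 cancel and the higher ones are
    nonnegative, so \<open>1 - z + z\<^sup>2\<close> dominates the reciprocal of
    \<open>exp z\<close>.\<close>
  have "1 \<le> (1 - z + z\<^sup>2) * (1 + z + z\<^sup>2 / 2)"
  proof -
    have "(1 - z + z\<^sup>2) * (1 + z + z\<^sup>2 / 2) = 1 + z\<^sup>2 / 2 + z ^ 3 / 2 + z ^ 4 / 2"
      by (simp add: power2_eq_square eval_nat_numeral field_simps)
    then show ?thesis using z by simp
  qed
  also have "\<dots> \<le> (1 - z + z\<^sup>2) * exp z"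
    using z by (intro mult_left_mono exp_lower_Taylor_quadratic) auto
  finally have "exp (- z) \<le> 1 - z + z\<^sup>2"
    by (simp add: exp_minus field_simps)
  then show ?thesis by (simp add: z_def)
qed

text \<open>Chernoff's argument by counting: the sum over all \<rho> factorizes over the groups,
  which is their independence, and mean 0 removes the linear term of each factor.\<close>

lemma hoeffding_count:
  fixes Y :: "nat \<Rightarrow> 'r \<Rightarrow> real"
  assumes R: "finite R" and Y: "\<And>g r. r \<in> R \<Longrightarrow> \<bar>Y g r\<bar> \<le> 1" "\<And>g. (\<Sum>r\<in>R. Y g r) = 0"
    and lam: "0 \<le> \<mu>" "\<mu> \<le> 2"
  shows "real (card {\<rho> \<in> PiE {..<n} (\<lambda>_. R). \<mu> * real n \<le> (\<Sum>g<n. Y g (\<rho> g))})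
    \<le> exp (- (\<mu>\<^sup>2 * real n / 4)) * real (card R) ^ n"
proof -
  \<comment> \<open>Minimizes \<open>\<theta>\<^sup>2 - \<theta> * \<mu>\<close>; by
    \<open>\<mu> \<le> 2\<close> it stays in the range of \<open>exp_le_quadratic\<close>.\<close>
  define \<theta> where "\<theta> = \<mu> / 2"
  have th: "0 \<le> \<theta>" "\<theta> \<le> 1" using lam by (auto simp: \<theta>_def)
  let ?\<Omega> = "PiE {..<n} (\<lambda>_. R)"
  have fin: "finite ?\<Omega>" using R by (intro finite_PiE) auto
  have mgf: "(\<Sum>r\<in>R. exp (\<theta> * Y g r)) \<le> real (card R) * exp (\<theta>\<^sup>2)" for g
  proof -
    have "(\<Sum>r\<in>R. exp (\<theta> * Y g r)) \<le> (\<Sum>r\<in>R. 1 + \<theta> * Y g r + \<theta>\<^sup>2)"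
    proof (rule sum_mono)
      fix r assume r: "r \<in> R"
      have "\<bar>\<theta> * Y g r\<bar> \<le> \<theta> * 1"
        unfolding abs_mult using Y(1)[OF r] th by (intro mult_mono) auto
      then have le: "\<bar>\<theta> * Y g r\<bar> \<le> \<theta>" by simp
      then have "exp (\<theta> * Y g r) \<le> 1 + \<theta> * Y g r + (\<theta> * Y g r)\<^sup>2"
        using th by (intro exp_le_quadratic) auto
      moreover have "(\<theta> * Y g r)\<^sup>2 \<le> \<theta>\<^sup>2" using power_mono[OF le, of 2] by simp
      ultimately show "exp (\<theta> * Y g r) \<le> 1 + \<theta> * Y g r + \<theta>\<^sup>2" by linarith
    qed
    also have "\<dots> = real (card R) * (1 + \<theta>\<^sup>2)"
      using Y(2)[of g] by (simp add: sum.distrib sum_distrib_left[symmetric] algebra_simps)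
    also have "\<dots> \<le> real (card R) * exp (\<theta>\<^sup>2)"
      by (intro mult_left_mono exp_ge_add_one_self) auto
    finally show ?thesis .
  qed
  have "real (card {\<rho> \<in> ?\<Omega>. \<mu> * real n \<le> (\<Sum>g<n. Y g (\<rho> g))})
      = (\<Sum>\<rho>\<in>?\<Omega>. of_bool (\<mu> * real n \<le> (\<Sum>g<n. Y g (\<rho> g))))"
    using fin by (simp add: sum_of_bool_eq Int_def)
  also have "\<dots> \<le> (\<Sum>\<rho>\<in>?\<Omega>. exp (- (\<theta> * (\<mu> * real n))) * (\<Prod>g<n. exp (\<theta> * Y g (\<rho> g))))"
  proof (rule sum_mono)
    fix \<rho>
    have "exp (- (\<theta> * (\<mu> * real n))) * (\<Prod>g<n. exp (\<theta> * Y g (\<rho> g)))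
        = exp (\<theta> * ((\<Sum>g<n. Y g (\<rho> g)) - \<mu> * real n))"
      by (simp add: exp_sum[symmetric] exp_add[symmetric] sum_distrib_left[symmetric] algebra_simps)
    moreover have "1 \<le> exp (\<theta> * ((\<Sum>g<n. Y g (\<rho> g)) - \<mu> * real n))"
      if "\<mu> * real n \<le> (\<Sum>g<n. Y g (\<rho> g))"
      using that th by simp
    ultimately show "of_bool (\<mu> * real n \<le> (\<Sum>g<n. Y g (\<rho> g)))
        \<le> exp (- (\<theta> * (\<mu> * real n))) * (\<Prod>g<n. exp (\<theta> * Y g (\<rho> g)))"
      by (simp add: of_bool_def)
  qed
  also have "\<dots> = exp (- (\<theta> * (\<mu> * real n))) * (\<Prod>g<n. \<Sum>r\<in>R. exp (\<theta> * Y g r))"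
    using R by (subst prod_sum_PiE) (simp_all add: sum_distrib_left)
  also have "\<dots> \<le> exp (- (\<theta> * (\<mu> * real n))) * (\<Prod>g<n. real (card R) * exp (\<theta>\<^sup>2))"
    using mgf by (intro mult_left_mono prod_mono) (auto intro: sum_nonneg)
  also have "\<dots> = exp (- (\<theta> * (\<mu> * real n)) + real n * \<theta>\<^sup>2) * real (card R) ^ n"
    unfolding exp_add exp_of_nat_mult by (simp add: power_mult_distrib)
  also have "- (\<theta> * (\<mu> * real n)) + real n * \<theta>\<^sup>2 = - (\<mu>\<^sup>2 * real n / 4)"
    by (simp add: \<theta>_def power2_eq_square field_simps)
  finally show ?thesis .
qed

section \<open>Imbalance of a fixed set under random rotations\<close>

definition ground :: "nat \<Rightarrow> nat \<Rightarrow> nat set" where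
  "ground l n = {..<n * (2 * l + 6)}"

lemma finite_ground [simp]: "finite (ground l n)"
  by (simp add: ground_def)

lemma card_ground: "card (ground l n) = n * (2 * l + 6)"
  by (simp add: ground_def)

lemma role_le: "role l r j \<le> 4" "role l r j < 2 \<longleftrightarrow> j < 2"
  by (auto simp: role_def Let_def)

lemma hidden_class_le: "hidden_class l \<rho> e \<le> 4"
  by (simp add: hidden_class_def role_le)

text \<open>Whether a class is below 2 depends on the position alone. Hence the matroid, which the
  algorithm is given, is the same for all \<rho>.\<close>

lemma hidden_class_selector: "hidden_class l \<rho> e < 2 \<longleftrightarrow> e \<in> selector l"
  by (simp add: hidden_class_def selector_def role_le)

lemma sum_hidden_class:
  fixes y :: "nat \<Rightarrow> real"
  assumes "S \<subseteq> ground l n"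
  shows "(\<Sum>e\<in>S. y (hidden_class l \<rho> e)) =
    (\<Sum>g<n. \<Sum>j<2 * l + 6. of_bool (g * (2 * l + 6) + j \<in> S) * y (role l (\<rho> g) j))"
proof -
  have "(\<Sum>e\<in>S. y (hidden_class l \<rho> e)) = (\<Sum>e\<in>ground l n. of_bool (e \<in> S) * y (hidden_class l \<rho> e))"
    using assms by (intro sum.mono_neutral_cong_left) auto
  also have "\<dots> = (\<Sum>g<n. \<Sum>j<2 * l + 6. of_bool (g * (2 * l + 6) + j \<in> S) * y (role l (\<rho> g) j))"
    unfolding ground_def sum_groups by (intro sum.cong) (auto simp: hidden_class_def)
  finally show ?thesis .
qed

definition dot :: "(nat \<Rightarrow> real) \<Rightarrow> (nat \<Rightarrow> real) \<Rightarrow> real" where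
  "dot y v = (\<Sum>i\<le>4. y i * v i)"

lemma dot_expand: "dot y v = y 0 * v 0 + y 1 * v 1 + y 2 * v 2 + y 3 * v 3 + y 4 * v 4"
  by (simp add: dot_def eval_nat_numeral)

lemma sum_eq_dot_profile:
  assumes "finite S" "\<And>e. e \<in> S \<Longrightarrow> cl e \<le> 4" "0 < n"
  shows "(\<Sum>e\<in>S. y (cl e)) = real n * dot y (profile cl n S)"
proof -
  have "(\<Sum>e\<in>S. y (cl e)) = (\<Sum>i\<le>4. \<Sum>e | e \<in> S \<and> cl e = i. y (cl e))"
    using assms by (intro sum.group[symmetric]) auto
  also have "\<dots> = (\<Sum>i\<le>4. real n * (y i * profile cl n S i))"
    using assms(3) by (intro sum.cong) (auto simp: profile_def)
  finally show ?thesis by (simp add: dot_def sum_distrib_left)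
qed

lemma group_index_less:
  fixes g j n M :: nat
  assumes "g < n" "j < M"
  shows "g * M + j < n * M"
proof -
  have "g * M + j < Suc g * M" using assms by simp
  also have "\<dots> \<le> n * M" using assms by (intro mult_le_mono1) simp
  finally show ?thesis .
qed

lemma profile_ground:
  assumes "0 < n"
  shows "profile (hidden_class l \<rho>) n (ground l n) i =
    of_bool (i = 0) + of_bool (i = 1) + of_bool (i = 2)
      + real (l + 1) * of_bool (i = 3) + real (l + 2) * of_bool (i = 4)"
proof -
  have "real (card {e \<in> ground l n. hidden_class l \<rho> e = i})
      = (\<Sum>e\<in>ground l n. of_bool (hidden_class l \<rho> e = i))"
    by (simp add: sum_of_bool_eq Int_def)
  also have "\<dots> = (\<Sum>g<n. \<Sum>j<2 * l + 6. of_bool (role l (\<rho> g) j = i))"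
    by (subst sum_hidden_class[OF order_refl, where y = "\<lambda>c. of_bool (c = i)"])
      (auto intro!: sum.cong simp: ground_def group_index_less simp del: sum_of_bool_eq)
  also have "\<dots> = real n * (of_bool (i = 0) + of_bool (i = 1) + of_bool (i = 2)
      + real (l + 1) * of_bool (i = 3) + real (l + 2) * of_bool (i = 4))"
    by (simp only: sum_role_positions[of "\<lambda>c. of_bool (c = i)"]) (auto simp: of_bool_def)
  finally show ?thesis using assms by (simp add: profile_def)
qed

lemma profile_mono:
  assumes "finite T" "S \<subseteq> T"
  shows "profile cl n S i \<le> profile cl n T i"
proof -
  have "card {e \<in> S. cl e = i} \<le> card {e \<in> T. cl e = i}"
    using assms by (intro card_mono) auto
  then show ?thesis by (simp add: profile_def divide_right_mono)
qed

lemma in_range_profile: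
  assumes "0 < n" "S \<subseteq> ground l n"
  shows "in_range l (profile (hidden_class l \<rho>) n S)"
proof -
  note u = profile_mono[OF finite_ground assms(2), of "hidden_class l \<rho>" n,
      unfolded profile_ground[OF assms(1)]]
  show ?thesis
    using u[of 0] u[of 1] u[of 2] u[of 3] u[of 4] by (simp add: in_range_def profile_def)
qed

text \<open>The right-hand sides do not mention \<rho>, so the symmetrized objective can be
  evaluated without knowing the partition.\<close>

lemma profile_sums:
  fixes l :: nat and \<rho> :: "nat \<Rightarrow> nat"
  assumes "0 < n" "S \<subseteq> ground l n"
  defines "v \<equiv> profile (hidden_class l \<rho>) n S"
  shows "v 0 + v 1 = real (card (S \<inter> selector l)) / real n"
    and "v 2 + v 3 + v 4 = real (card (S - selector l)) / real n"
proof -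
  have fin: "finite S" by (rule finite_subset[OF assms(2) finite_ground])
  have "real (card (S \<inter> selector l)) = (\<Sum>e\<in>S. of_bool (hidden_class l \<rho> e < 2))"
    using fin by (simp add: sum_of_bool_eq hidden_class_selector)
  also have "\<dots> = real n * dot (\<lambda>c. of_bool (c < 2)) v"
    unfolding v_def using fin assms(1) by (intro sum_eq_dot_profile) (auto simp: hidden_class_le)
  finally show "v 0 + v 1 = real (card (S \<inter> selector l)) / real n"
    using assms(1) by (simp add: dot_expand)
  have "real (card (S - selector l)) = (\<Sum>e\<in>S. of_bool (\<not> hidden_class l \<rho> e < 2))"
    using fin by (simp add: sum_of_bool_eq hidden_class_selector Collect_neg_eq Diff_eq)
  also have "\<dots> = real n * dot (\<lambda>c. of_bool (\<not> c < 2)) v"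
    unfolding v_def using fin assms(1)
    by (intro sum_eq_dot_profile[where y = "\<lambda>c. of_bool (\<not> c < 2)"]) (auto simp: hidden_class_le)
  finally show "v 2 + v 3 + v 4 = real (card (S - selector l)) / real n"
    using assms(1) by (simp add: dot_expand)
qed

abbreviation rotations :: "nat \<Rightarrow> nat \<Rightarrow> (nat \<Rightarrow> nat) set" where
  "rotations l n \<equiv> PiE {..<n} (\<lambda>_. {..<2 * l + 4})"

text \<open>The hypotheses on \<open>y\<close> say that the contribution of a group has mean 0 over
  its rotations and absolute value at most 2. Halving it fits \<open>hoeffding_count\<close>, which
  produces the 16.\<close>

lemma dot_concentration:
  assumes n: "0 < n" and S: "S \<subseteq> ground l n"
    and y: "y 0 + y 1 = 0" "y 2 + real (l + 1) * y 3 + real (l + 2) * y 4 = 0"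
      "\<bar>y 0\<bar> + \<bar>y 1\<bar> + \<bar>y 2\<bar> + real (l + 1) * \<bar>y 3\<bar> + real (l + 2) * \<bar>y 4\<bar> \<le> 2"
    and lam: "0 \<le> \<mu>" "\<mu> \<le> 1"
  shows "real (card {\<rho> \<in> rotations l n. \<mu> < dot y (profile (hidden_class l \<rho>) n S)})
    \<le> exp (- (\<mu>\<^sup>2 * real n / 16)) * real (card (rotations l n))"
proof -
  define Y where "Y g r = (\<Sum>j<2 * l + 6. of_bool (g * (2 * l + 6) + j \<in> S) * y (role l r j)) / 2"
    for g r
  have fin: "finite S" by (rule finite_subset[OF S finite_ground])
  have "\<bar>Y g r\<bar> \<le> 1" for g r
  proof -
    have "\<bar>\<Sum>j<2 * l + 6. of_bool (g * (2 * l + 6) + j \<in> S) * y (role l r j)\<bar>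
        \<le> (\<Sum>j<2 * l + 6. \<bar>y (role l r j)\<bar>)"
      by (rule order_trans[OF sum_abs sum_mono]) simp
    also have "\<dots> \<le> 2"
      using y(3) by (simp only: sum_role_positions[of "\<lambda>c. \<bar>y c\<bar>"])
    finally show ?thesis by (simp add: Y_def)
  qed
  moreover have "(\<Sum>r<2 * l + 4. Y g r) = 0" for g
  proof -
    have "(\<Sum>r<2 * l + 4. \<Sum>j<2 * l + 6. of_bool (g * (2 * l + 6) + j \<in> S) * y (role l r j))
        = (\<Sum>j<2 * l + 6. of_bool (g * (2 * l + 6) + j \<in> S) * (\<Sum>r<2 * l + 4. y (role l r j)))"
      by (subst sum.swap) (simp only: sum_distrib_left)
    also have "\<dots> = 0" unfolding sum_role_rotations y(1,2) by (intro sum.neutral) auto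
    finally show ?thesis by (simp add: Y_def sum_divide_distrib[symmetric])
  qed
  ultimately have count: "real (card {\<rho> \<in> rotations l n. (\<mu> / 2) * real n \<le> (\<Sum>g<n. Y g (\<rho> g))})
      \<le> exp (- ((\<mu> / 2)\<^sup>2 * real n / 4)) * real (card {..<2 * l + 4}) ^ n"
    using lam by (intro hoeffding_count) auto
  have "{\<rho> \<in> rotations l n. \<mu> < dot y (profile (hidden_class l \<rho>) n S)}
      \<subseteq> {\<rho> \<in> rotations l n. (\<mu> / 2) * real n \<le> (\<Sum>g<n. Y g (\<rho> g))}"
  proof safe
    fix \<rho> assume "\<mu> < dot y (profile (hidden_class l \<rho>) n S)"
    then have "\<mu> * real n \<le> real n * dot y (profile (hidden_class l \<rho>) n S)"
      using n by (simp add: mult.commute)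
    also have "\<dots> = (\<Sum>e\<in>S. y (hidden_class l \<rho> e))"
      using fin n by (intro sum_eq_dot_profile[symmetric]) (auto simp: hidden_class_le)
    also have "\<dots> = 2 * (\<Sum>g<n. Y g (\<rho> g))"
      unfolding sum_hidden_class[OF S] Y_def sum_divide_distrib[symmetric] by simp
    finally show "(\<mu> / 2) * real n \<le> (\<Sum>g<n. Y g (\<rho> g))" by simp
  qed
  then have "card {\<rho> \<in> rotations l n. \<mu> < dot y (profile (hidden_class l \<rho>) n S)}
      \<le> card {\<rho> \<in> rotations l n. (\<mu> / 2) * real n \<le> (\<Sum>g<n. Y g (\<rho> g))}"
    by (intro card_mono) (simp_all add: finite_PiE)
  with count show ?thesis by (simp add: card_PiE power_divide)
qed

text \<open>If the mean of three squares exceeds \<delta>, so does one of them; three differences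
  with two signs each give the factor 6.\<close>

lemma imbalance_concentration:
  assumes n: "0 < n" and S: "S \<subseteq> ground l n" and d: "0 \<le> \<delta>" "\<delta> \<le> 1"
  shows "real (card {\<rho> \<in> rotations l n. \<delta> < imbalance l (profile (hidden_class l \<rho>) n S)})
    \<le> 6 * exp (- (\<delta> * real n / 16)) * real (card (rotations l n))"
proof -
  define y1 y2 y3 :: "nat \<Rightarrow> real" where
    "y1 i = of_bool (i = 0) - of_bool (i = 1)" and
    "y2 i = of_bool (i = 2) - of_bool (i = 3) / real (l + 1)" and
    "y3 i = of_bool (i = 2) - of_bool (i = 4) / real (l + 2)" for i
  let ?bad = "\<lambda>y. {\<rho> \<in> rotations l n. sqrt \<delta> < dot y (profile (hidden_class l \<rho>) n S)}"
  define K where "K = exp (- (\<delta> * real n / 16)) * real (card (rotations l n))"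
  have fin: "finite (rotations l n)" by (intro finite_PiE) auto
  define adm :: "(nat \<Rightarrow> real) \<Rightarrow> bool" where "adm y \<longleftrightarrow> y 0 + y 1 = 0
    \<and> y 2 + real (l + 1) * y 3 + real (l + 2) * y 4 = 0
    \<and> \<bar>y 0\<bar> + \<bar>y 1\<bar> + \<bar>y 2\<bar> + real (l + 1) * \<bar>y 3\<bar> + real (l + 2) * \<bar>y 4\<bar> \<le> 2" for y
  have adm_K: "real (card (?bad y)) \<le> K" if "adm y" for y
    using dot_concentration[OF n S, of y "sqrt \<delta>"] that d by (simp add: adm_def K_def)
  have "adm y1" "adm y2" "adm y3"
    by (simp_all add: adm_def y1_def y2_def y3_def)
  moreover have "adm (\<lambda>i. - y i)" if "adm y" for y
    using that by (simp add: adm_def)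
  ultimately have c: "real (card (?bad y)) \<le> K" "real (card (?bad (\<lambda>i. - y i))) \<le> K"
    if "y = y1 \<or> y = y2 \<or> y = y3" for y
    using that adm_K by blast+
  have sub: "{\<rho> \<in> rotations l n. \<delta> < imbalance l (profile (hidden_class l \<rho>) n S)}
      \<subseteq> (\<Union>y\<in>{y1, y2, y3}. ?bad y \<union> ?bad (\<lambda>i. - y i))"
  proof
    fix \<rho> assume "\<rho> \<in> {\<rho> \<in> rotations l n. \<delta> < imbalance l (profile (hidden_class l \<rho>) n S)}"
    then have rho: "\<rho> \<in> rotations l n" and im: "\<delta> < imbalance l (profile (hidden_class l \<rho>) n S)" by auto
    define v where "v = profile (hidden_class l \<rho>) n S"
    have eq: "imbalance l v = ((dot y1 v)\<^sup>2 + (dot y2 v)\<^sup>2 + (dot y3 v)\<^sup>2) / 3"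
      by (simp add: imbalance_def dot_expand y1_def y2_def y3_def resP_def resQ_def resR_def
          power2_commute)
    have "\<exists>y\<in>{y1, y2, y3}. \<delta> < (dot y v)\<^sup>2"
      using im unfolding v_def[symmetric] eq by (rule_tac ccontr) auto
    then obtain y where y: "y \<in> {y1, y2, y3}" "\<delta> < (dot y v)\<^sup>2" by blast
    from y(2) have "sqrt \<delta> < \<bar>dot y v\<bar>" using real_sqrt_less_mono by fastforce
    moreover have "dot (\<lambda>i. - y i) v = - dot y v" by (simp add: dot_def sum_negf)
    ultimately have "sqrt \<delta> < dot y v \<or> sqrt \<delta> < dot (\<lambda>i. - y i) v" by linarith
    then show "\<rho> \<in> (\<Union>y\<in>{y1, y2, y3}. ?bad y \<union> ?bad (\<lambda>i. - y i))"
      using y(1) rho by (auto simp: v_def)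
  qed
  have "card {\<rho> \<in> rotations l n. \<delta> < imbalance l (profile (hidden_class l \<rho>) n S)}
      \<le> card (\<Union>y\<in>{y1, y2, y3}. ?bad y \<union> ?bad (\<lambda>i. - y i))"
    using fin by (intro card_mono sub) auto
  also have "\<dots> = card (?bad y1 \<union> ?bad (\<lambda>i. - y1 i) \<union> (?bad y2 \<union> ?bad (\<lambda>i. - y2 i))
      \<union> (?bad y3 \<union> ?bad (\<lambda>i. - y3 i)))"
    by (simp add: Un_ac)
  also have "\<dots> \<le> card (?bad y1) + card (?bad (\<lambda>i. - y1 i)) + (card (?bad y2) + card (?bad (\<lambda>i. - y2 i)))
      + (card (?bad y3) + card (?bad (\<lambda>i. - y3 i)))"
    by (intro order_trans[OF card_Un_le] add_mono card_Un_le)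
  finally have "real (card {\<rho> \<in> rotations l n. \<delta> < imbalance l (profile (hidden_class l \<rho>) n S)})
      \<le> 6 * K"
    using c[of y1] c[of y2] c[of y3] by simp
  then show ?thesis by (simp add: K_def)
qed

subsection \<open>The matroid\<close>

definition partition_indep :: "'a set \<Rightarrow> 'a set \<Rightarrow> nat \<Rightarrow> 'a set set" where
  "partition_indep X A n = {S. S \<subseteq> X \<and> card (S \<inter> A) \<le> n \<and> card (S - A) \<le> n}"

lemma matroid_partition_indep:
  assumes X: "finite X"
  shows "matroid X (partition_indep X A n)"
proof -
  have sub: "T \<in> partition_indep X A n" if "S \<in> partition_indep X A n" "T \<subseteq> S" for S T
  proof -
    have "finite S" using that X by (auto simp: partition_indep_def intro: finite_subset)
    then have "card (T \<inter> A) \<le> card (S \<inter> A)" "card (T - A) \<le> card (S - A)"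
      using that(2) by (auto intro!: card_mono)
    then show ?thesis using that by (auto simp: partition_indep_def)
  qed
  have aug: "\<exists>x\<in>T - S. insert x S \<in> partition_indep X A n"
    if S: "S \<in> partition_indep X A n" and T: "T \<in> partition_indep X A n" and less: "card S < card T"
    for S T
  proof -
    have fin: "finite S" "finite T"
      using S T X by (auto simp: partition_indep_def intro: finite_subset)
    have "card U = card (U \<inter> A) + card (U - A)" if "finite U" for U
      using card_Int_Diff[OF that] .
    then consider "card (S \<inter> A) < card (T \<inter> A)" | "card (S - A) < card (T - A)"
      using less fin by (metis add_le_mono not_le)
    then show ?thesis
    proof cases
      case 1
      then obtain x where x: "x \<in> T \<inter> A" "x \<notin> S \<inter> A"
        using fin card_mono[of "S \<inter> A" "T \<inter> A"] by (metis finite_Int not_le subsetI)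
      have "insert x S \<inter> A = insert x (S \<inter> A)" "insert x S - A = S - A" using x by auto
      then have "insert x S \<in> partition_indep X A n"
        using x 1 S T fin by (auto simp: partition_indep_def)
      then show ?thesis using x by blast
    next
      case 2
      then obtain x where x: "x \<in> T - A" "x \<notin> S - A"
        using fin card_mono[of "S - A" "T - A"] by (metis finite_Diff not_le subsetI)
      have "insert x S \<inter> A = S \<inter> A" "insert x S - A = insert x (S - A)" using x by auto
      then have "insert x S \<in> partition_indep X A n"
        using x 2 S T fin by (auto simp: partition_indep_def)
      then show ?thesis using x by blast
    qed
  qed
  have "partition_indep X A n \<subseteq> Pow X" "{} \<in> partition_indep X A n"
    by (auto simp: partition_indep_def)
  then show ?thesis
    unfolding matroid_def using X sub aug by blast
qed

lemma bases_partition_indep: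
  assumes X: "finite X" and big: "n \<le> card (X \<inter> A)" "n \<le> card (X - A)"
  shows "B \<in> bases (partition_indep X A n) \<longleftrightarrow> B \<subseteq> X \<and> card (B \<inter> A) = n \<and> card (B - A) = n"
proof
  assume B: "B \<in> bases (partition_indep X A n)"
  then have ind: "B \<subseteq> X" "card (B \<inter> A) \<le> n" "card (B - A) \<le> n"
    and max: "\<And>C. C \<in> partition_indep X A n \<Longrightarrow> B \<subseteq> C \<Longrightarrow> C = B"
    by (auto simp: bases_def partition_indep_def)
  have fin: "finite B" using ind X finite_subset by metis
  have "\<not> card (B \<inter> A) < n"
  proof
    assume less: "card (B \<inter> A) < n"
    then obtain x where x: "x \<in> X \<inter> A" "x \<notin> B \<inter> A"
      using big(1) fin card_mono[of "B \<inter> A" "X \<inter> A"] by (metis finite_Int le_trans not_le subsetI)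
    have "insert x B \<inter> A = insert x (B \<inter> A)" "insert x B - A = B - A" using x by auto
    then have "insert x B \<in> partition_indep X A n"
      using x less ind fin by (auto simp: partition_indep_def)
    with max[of "insert x B"] x show False by blast
  qed
  moreover have "\<not> card (B - A) < n"
  proof
    assume less: "card (B - A) < n"
    then obtain x where x: "x \<in> X - A" "x \<notin> B - A"
      using big(2) fin card_mono[of "B - A" "X - A"] by (metis finite_Diff le_trans not_le subsetI)
    have "insert x B \<inter> A = B \<inter> A" "insert x B - A = insert x (B - A)" using x by auto
    then have "insert x B \<in> partition_indep X A n"
      using x less ind fin by (auto simp: partition_indep_def)
    with max[of "insert x B"] x show False by blast
  qed
  ultimately show "B \<subseteq> X \<and> card (B \<inter> A) = n \<and> card (B - A) = n" using ind by simp
next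
  assume B: "B \<subseteq> X \<and> card (B \<inter> A) = n \<and> card (B - A) = n"
  have "C = B" if C: "C \<in> partition_indep X A n" "B \<subseteq> C" for C
  proof -
    have fin: "finite C" using C X by (auto simp: partition_indep_def intro: finite_subset)
    have "B \<inter> A = C \<inter> A" "B - A = C - A"
      using fin B C by (intro card_seteq; auto simp: partition_indep_def)+
    then show ?thesis by blast
  qed
  then show "B \<in> bases (partition_indep X A n)"
    using B by (auto simp: bases_def partition_indep_def)
qed

lemma fractional_base_packing_number_ge_2:
  assumes fin: "finite (bases \<J>)" and B: "B1 \<in> bases \<J>" "B2 \<in> bases \<J>" "B1 \<noteq> B2" "B1 \<inter> B2 = {}"
  shows "2 \<le> fractional_base_packing_number X \<J>"
proof -
  define w :: "'a set \<Rightarrow> real" where "w B = of_bool (B = B1) + of_bool (B = B2)" for B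
  have eq: "(\<Sum>B\<in>bases \<J>. w B * h B) = h B1 + h B2" for h
    using fin B by (simp add: w_def distrib_right sum.distrib)
  have "(\<Sum>B\<in>bases \<J>. w B) = 2" using eq[of "\<lambda>_. 1"] by simp
  moreover have "(\<Sum>B\<in>bases \<J>. w B * indicator B x) \<le> 1" for x
    using B(4) unfolding eq by (auto simp: indicator_def)
  moreover have "0 \<le> w B" for B by (simp add: w_def)
  ultimately have "ereal 2 \<in> {ereal (\<Sum>B\<in>bases \<J>. w B) | w. (\<forall>B\<in>bases \<J>. 0 \<le> w B) \<and>
      (\<forall>x\<in>X. (\<Sum>B\<in>bases \<J>. w B * indicator B x) \<le> 1)}"
    by (intro CollectI exI[of _ w]) simp
  then have "ereal 2 \<le> fractional_base_packing_number X \<J>"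
    unfolding fractional_base_packing_number_def by (rule Sup_upper)
  then show ?thesis by simp
qed

section \<open>Hidden optimal bases and the packing number\<close>

definition hidden_base :: "nat \<Rightarrow> nat \<Rightarrow> (nat \<Rightarrow> nat) \<Rightarrow> nat set" where
  "hidden_base l n \<rho> = {e \<in> ground l n. hidden_class l \<rho> e = 1 \<or> hidden_class l \<rho> e = 2}"

text \<open>Capacity \<open>n\<close> on either part is mass 1 in the normalization of
  \<open>profile\<close>.\<close>

abbreviation indep :: "nat \<Rightarrow> nat \<Rightarrow> nat set set" where
  "indep l n \<equiv> partition_indep (ground l n) (selector l) n"

lemma card_hidden_class:
  assumes "0 < n"
  shows "card {e \<in> ground l n. hidden_class l \<rho> e = 1} = n"
    "card {e \<in> ground l n. hidden_class l \<rho> e = 2} = n"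
  using profile_ground[OF assms, of l \<rho> 1] profile_ground[OF assms, of l \<rho> 2] assms
  by (simp_all add: profile_def)

lemma hidden_base_split:
  "hidden_base l n \<rho> \<inter> selector l = {e \<in> ground l n. hidden_class l \<rho> e = 1}"
  "hidden_base l n \<rho> - selector l = {e \<in> ground l n. hidden_class l \<rho> e = 2}"
  by (auto simp: hidden_base_def hidden_class_selector[where \<rho> = \<rho>, symmetric])

lemma bases_indep:
  assumes "0 < n"
  shows "B \<in> bases (indep l n) \<longleftrightarrow>
    B \<subseteq> ground l n \<and> card (B \<inter> selector l) = n \<and> card (B - selector l) = n"
proof (rule bases_partition_indep)
  have "hidden_base l n (\<lambda>_. 0) \<subseteq> ground l n" by (auto simp: hidden_base_def)
  then have "card (hidden_base l n (\<lambda>_. 0) \<inter> selector l) \<le> card (ground l n \<inter> selector l)"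
    "card (hidden_base l n (\<lambda>_. 0) - selector l) \<le> card (ground l n - selector l)"
    by (auto intro!: card_mono)
  then show "n \<le> card (ground l n \<inter> selector l)" "n \<le> card (ground l n - selector l)"
    unfolding hidden_base_split card_hidden_class[OF assms] .
qed simp

lemma hidden_base_in_bases: "0 < n \<Longrightarrow> hidden_base l n \<rho> \<in> bases (indep l n)"
  unfolding bases_indep hidden_base_split card_hidden_class by (auto simp: hidden_base_def)

lemma finite_bases_indep: "finite (bases (indep l n))"
  by (rule finite_subset[of _ "Pow (ground l n)"]) (auto simp: bases_def partition_indep_def)

lemma packing_indep:
  assumes "0 < n"
  shows "2 \<le> fractional_base_packing_number (ground l n) (indep l n)"
proof (rule fractional_base_packing_number_ge_2[OF finite_bases_indep])
  show disj: "hidden_base l n (\<lambda>_. 0) \<inter> hidden_base l n (\<lambda>_. 1) = {}"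
  proof -
    \<comment> \<open>Raising the rotation by one flips the parity at the selector positions and
      moves residue 0 to another main position.\<close>
    have "\<not> ((role l 0 j = 1 \<or> role l 0 j = 2) \<and> (role l 1 j = 1 \<or> role l 1 j = 2))" for j
    proof (cases "j < 2")
      case True
      then have "j = 0 \<or> j = 1" by auto
      then show ?thesis by (auto simp: role_def Let_def)
    next
      case False
      then show ?thesis by (auto simp: role_def Let_def mod_Suc split: if_splits)
    qed
    then show ?thesis by (fastforce simp: hidden_base_def hidden_class_def)
  qed
  have "hidden_base l n (\<lambda>_. 0) \<noteq> {}"
    using card_hidden_class(1)[OF assms, of l "\<lambda>_. 0"] hidden_base_split(1)[of l n "\<lambda>_. 0"] assms
    by (metis Int_empty_left card.empty less_irrefl)
  then show "hidden_base l n (\<lambda>_. 0) \<noteq> hidden_base l n (\<lambda>_. 1)" using disj by auto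
qed (simp_all add: hidden_base_in_bases assms)

subsection \<open>The instances\<close>

definition hidden_objective :: "nat \<Rightarrow> real \<Rightarrow> real \<Rightarrow> nat \<Rightarrow> (nat \<Rightarrow> nat) \<Rightarrow> nat set \<Rightarrow> real" where
  "hidden_objective l a \<kappa> n \<rho> S = blend l (cutoff a) \<kappa> (profile (hidden_class l \<rho>) n S)"

text \<open>Any rotation in place of 0 would give the same values on subsets of the ground set,
  since with weight 0 only functions of the two totals remain.\<close>

definition symmetric_objective :: "nat \<Rightarrow> real \<Rightarrow> nat \<Rightarrow> nat set \<Rightarrow> real" where
  "symmetric_objective l \<kappa> n S = blend l (\<lambda>_. 0) \<kappa> (profile (hidden_class l (\<lambda>_. 0)) n S)"

lemma hidden_objective_balanced:
  assumes "0 < n" "S \<subseteq> ground l n" "0 < a"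
    and "imbalance l (profile (hidden_class l \<rho>) n S) \<le> exp (- 1 / a)"
  shows "hidden_objective l a \<kappa> n \<rho> S = symmetric_objective l \<kappa> n S"
proof -
  have "cutoff a (imbalance l (profile (hidden_class l \<rho>) n S)) = 0"
    using assms by (intro cutoff_eq_0)
  moreover have "symm l v = (2 - (v 0 + v 1)) * (1 - (1 - (v 2 + v 3 + v 4) / (2 * real (l + 2))) ^ (l + 2))"
    "slack l v = (2 * real (l + 2) + 2)\<^sup>2 - ((v 0 + v 1) + (v 2 + v 3 + v 4))\<^sup>2" for v
    by (simp_all add: symm_def slack_def resZ_def algebra_simps)
  ultimately show ?thesis
    unfolding hidden_objective_def symmetric_objective_def blend_def
    by (simp only: profile_sums[OF assms(1,2)])
qed

lemma symmetric_objective_base: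
  assumes "0 < n" "B \<in> bases (indep l n)" "0 \<le> \<kappa>"
  shows "symmetric_objective l \<kappa> n B
    \<le> 1 - (1 - 1 / (2 * real (l + 2))) ^ (l + 2) + \<kappa> * (2 * real (l + 2) + 2)\<^sup>2"
proof -
  define v where "v = profile (hidden_class l (\<lambda>_. 0)) n B"
  have B: "B \<subseteq> ground l n" "card (B \<inter> selector l) = n" "card (B - selector l) = n"
    using assms(2) bases_indep[OF assms(1)] by auto
  have v: "v 0 + v 1 = 1" "v 2 + v 3 + v 4 = 1"
    using profile_sums[OF assms(1) B(1), of "\<lambda>_. 0"] B assms(1) by (simp_all add: v_def)
  have "symm l v = (2 - (v 0 + v 1)) * (1 - (1 - (v 2 + v 3 + v 4) / (2 * real (l + 2))) ^ (l + 2))"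
    by (simp add: symm_def resZ_def algebra_simps)
  then have "symm l v = 1 - (1 - 1 / (2 * real (l + 2))) ^ (l + 2)" unfolding v by simp
  moreover have "\<kappa> * slack l v \<le> \<kappa> * (2 * real (l + 2) + 2)\<^sup>2"
    using assms(3) by (intro mult_left_mono) (simp_all add: slack_def)
  ultimately show ?thesis by (simp add: symmetric_objective_def blend_def v_def)
qed

lemma hidden_objective_hidden_base:
  assumes "0 < n" "0 \<le> \<kappa>"
  shows "1 \<le> hidden_objective l a \<kappa> n \<rho> (hidden_base l n \<rho>)"
proof -
  define v where "v = profile (hidden_class l \<rho>) n (hidden_base l n \<rho>)"
  have sub: "hidden_base l n \<rho> \<subseteq> ground l n" by (auto simp: hidden_base_def)
  have "{e \<in> hidden_base l n \<rho>. hidden_class l \<rho> e = i} =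
      (if i = 1 \<or> i = 2 then {e \<in> ground l n. hidden_class l \<rho> e = i} else {})" for i
    by (auto simp: hidden_base_def)
  then have v: "v 0 = 0" "v 1 = 1" "v 2 = 1" "v 3 = 0" "v 4 = 0"
    using card_hidden_class[OF assms(1), of l \<rho>] assms(1) by (simp_all add: v_def profile_def)
  have "imbalance l v = 1" unfolding imbalance_def resP_def resQ_def resR_def v by simp
  moreover have "skewed l v = 1" unfolding skewed_def resP_def resQ_def resR_def v by simp
  ultimately show ?thesis
    using blend_bounds(3)[of l v "cutoff a" \<kappa>] in_range_profile[OF assms(1) sub, of \<rho>] assms(2)
    by (simp add: hidden_objective_def v_def)
qed

lemma hidden_objective_bounds:
  assumes "0 < n" "S \<subseteq> ground l n" "0 < a" "a \<le> 1" "0 \<le> \<kappa>"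
  shows "0 \<le> hidden_objective l a \<kappa> n \<rho> S"
    "hidden_objective l a \<kappa> n \<rho> S \<le> 2 + \<kappa> * (2 * real (l + 2) + 2)\<^sup>2"
proof -
  let ?v = "profile (hidden_class l \<rho>) n S"
  have b: "in_range l ?v" using in_range_profile assms by blast
  then have "0 \<le> cutoff a (imbalance l ?v)" "cutoff a (imbalance l ?v) \<le> 1"
    using cutoff_bounds[OF assms(3,4) imbalance_nonneg imbalance_le_1] by auto
  then show "0 \<le> hidden_objective l a \<kappa> n \<rho> S"
    "hidden_objective l a \<kappa> n \<rho> S \<le> 2 + \<kappa> * (2 * real (l + 2) + 2)\<^sup>2"
    using blend_bounds[OF b, of "cutoff a" \<kappa>] assms(5) by (auto simp: hidden_objective_def)
qed

lemma submodular_base_instance_hidden: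
  assumes "0 < n" "0 < a" "a \<le> 1" "6000 * a * (real (l + 2))\<^sup>2 \<le> \<kappa>"
  shows "submodular_base_instance (ground l n, indep l n, hidden_objective l a \<kappa> n \<rho>)"
proof -
  have "0 \<le> 6000 * a * (real (l + 2))\<^sup>2" using assms by simp
  then have k: "0 \<le> \<kappa>" using assms by linarith
  have "submodular_on (ground l n) (\<lambda>S. blend l (cutoff a) \<kappa> (profile (hidden_class l \<rho>) n S))"
    using assms cutoff_bounds[OF assms(2,3)] DERIV_cutoff[OF assms(2)] in_range_profile
    by (intro submodular_on_blend[where a = a and \<phi>' = "cutoff' a" and \<phi>'' = "cutoff'' a"])
      (auto simp: hidden_class_le)
  then show ?thesis
    using matroid_partition_indep[OF finite_ground] hidden_objective_bounds[OF assms(1) _ assms(2,3) k]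
    by (auto simp: submodular_base_instance_def nonnegative_on_def hidden_objective_def[abs_def])
qed

lemma submodular_base_instance_symmetric:
  assumes "0 < n" "0 \<le> \<kappa>"
  shows "submodular_base_instance (ground l n, indep l n, symmetric_objective l \<kappa> n)"
proof -
  have "submodular_on (ground l n)
      (\<lambda>S. blend l (\<lambda>_. 0) \<kappa> (profile (hidden_class l (\<lambda>_. 0)) n S))"
    using assms in_range_profile
    by (intro submodular_on_blend[where a = 0 and \<phi>' = "\<lambda>_. 0" and \<phi>'' = "\<lambda>_. 0"])
      (auto simp: hidden_class_le)
  moreover have "0 \<le> blend l (\<lambda>_. 0) \<kappa> (profile (hidden_class l (\<lambda>_. 0)) n S)"
    if "S \<subseteq> ground l n" for S
    using blend_bounds(1)[of l _ "\<lambda>_. 0"] in_range_profile[OF assms(1) that] assms(2) by simp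
  ultimately show ?thesis
    using matroid_partition_indep[OF finite_ground]
    by (auto simp: submodular_base_instance_def nonnegative_on_def symmetric_objective_def[abs_def])
qed

subsection \<open>Query complexity\<close>

primrec queried :: "('a set \<Rightarrow> real) \<Rightarrow> 'a query_strategy \<Rightarrow> 'a set set" where
  "queried g (Answer S) = {}"
| "queried g (Query S k) = insert S (queried g (k (g S)))"

text \<open>The replies coincide along the run on \<open>g\<close>, so the run on \<open>f\<close>
  follows the same branch of the strategy.\<close>

lemma answer_cong_queried:
  "(\<And>S. S \<in> queried g t \<Longrightarrow> f S = g S) \<Longrightarrow> answer f t = answer g t"
  by (induction t) auto

lemma finite_queried: "finite (queried g t)"
  by (induction t) auto

lemma card_queried_le: "card (queried g t) \<le> num_queries g t"
  by (induction t) (auto intro: card_insert_le_m1 simp: card_insert_if finite_queried le_SucI)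

lemma queried_subset: "queries_within X t \<Longrightarrow> S \<in> queried g t \<Longrightarrow> S \<subseteq> X"
  by (induction t) auto

text \<open>Yao's averaging: \<open>p\<close> does not depend on \<omega>, so for each strategy in
  its support the mean over \<open>\<Omega>\<close> can be estimated, and some \<omega> does no
  better than the average. A run on \<open>f \<omega>\<close> coincides with the run on
  \<open>g\<close> unless the functions differ on a set occurring in the latter.\<close>

lemma average_case_bound:
  fixes p :: "'a query_strategy pmf" and f :: "'b \<Rightarrow> 'a set \<Rightarrow> real"
  assumes \<Omega>: "finite \<Omega>" "\<Omega> \<noteq> {}" and pos: "0 \<le> \<beta>" "0 \<le> C" "0 \<le> \<tau>"
    and supp: "\<And>t. t \<in> set_pmf p \<Longrightarrow> queries_within X t \<and> real (num_queries g t) \<le> q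
      \<and> answer g t \<subseteq> X \<and> g (answer g t) \<le> \<beta>"
    and bound: "\<And>t \<omega>. \<lbrakk>t \<in> set_pmf p; \<omega> \<in> \<Omega>\<rbrakk> \<Longrightarrow> 0 \<le> f \<omega> (answer (f \<omega>) t) \<and> f \<omega> (answer (f \<omega>) t) \<le> C"
    and agree: "\<And>S. S \<subseteq> X \<Longrightarrow> real (card {\<omega> \<in> \<Omega>. f \<omega> S \<noteq> g S}) \<le> \<tau> * real (card \<Omega>)"
  shows "\<exists>\<omega>\<in>\<Omega>. measure_pmf.expectation p (\<lambda>t. f \<omega> (answer (f \<omega>) t)) \<le> \<beta> + C * ((q + 1) * \<tau>)"
proof (rule ccontr)
  define h where "h \<omega> t = f \<omega> (answer (f \<omega>) t)" for \<omega> t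
  define K where "K = \<beta> + C * ((q + 1) * \<tau>)"
  assume "\<not> ?thesis"
  then have big: "K < measure_pmf.expectation p (h \<omega>)" if "\<omega> \<in> \<Omega>" for \<omega>
    using that by (auto simp: K_def h_def[abs_def] not_le)
  have int: "integrable (measure_pmf p) (h \<omega>)" if "\<omega> \<in> \<Omega>" for \<omega>
    using bound that
    by (intro measure_pmf.integrable_const_bound[where B = C]) (auto simp: AE_measure_pmf_iff h_def)
  have avg: "(\<Sum>\<omega>\<in>\<Omega>. h \<omega> t) \<le> real (card \<Omega>) * K" if t: "t \<in> set_pmf p" for t
  proof -
    \<comment> \<open>Including the answer makes its value agree with \<open>g\<close> too; hence
      the bound \<open>q + 1\<close>.\<close>
    define Q where "Q = insert (answer g t) (queried g t)"
    define bad where "bad = (\<Union>S\<in>Q. {\<omega> \<in> \<Omega>. f \<omega> S \<noteq> g S})"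
    have Q: "finite Q" "\<And>S. S \<in> Q \<Longrightarrow> S \<subseteq> X"
      using supp[OF t] queried_subset[of X t] unfolding Q_def by (simp add: finite_queried, blast)
    have "card Q \<le> Suc (num_queries g t)"
      using card_queried_le[of g t] by (auto simp: Q_def card_insert_if finite_queried)
    then have cardQ: "real (card Q) \<le> q + 1" using supp[OF t] by linarith
    have "h \<omega> t \<le> \<beta> + C * of_bool (\<omega> \<in> bad)" if "\<omega> \<in> \<Omega>" for \<omega>
    proof (cases "\<omega> \<in> bad")
      case True
      then show ?thesis using bound[OF t that] pos by (simp add: h_def)
    next
      case False
      then have eq: "f \<omega> S = g S" if "S \<in> Q" for S using that \<open>\<omega> \<in> \<Omega>\<close> by (auto simp: bad_def)
      then have "answer (f \<omega>) t = answer g t" by (intro answer_cong_queried) (auto simp: Q_def)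
      then show ?thesis using eq[of "answer g t"] supp[OF t] False by (simp add: h_def Q_def)
    qed
    then have le: "(\<Sum>\<omega>\<in>\<Omega>. h \<omega> t) \<le> (\<Sum>\<omega>\<in>\<Omega>. \<beta> + C * of_bool (\<omega> \<in> bad))" by (rule sum_mono)
    have "\<Omega> \<inter> bad = bad" by (auto simp: bad_def)
    then have eq: "(\<Sum>\<omega>\<in>\<Omega>. \<beta> + C * of_bool (\<omega> \<in> bad)) = real (card \<Omega>) * \<beta> + C * real (card bad)"
      using \<Omega> by (simp add: sum.distrib sum_distrib_left[symmetric] sum_of_bool_eq)
    have "real (card bad) \<le> (\<Sum>S\<in>Q. real (card {\<omega> \<in> \<Omega>. f \<omega> S \<noteq> g S}))"
      unfolding bad_def of_nat_sum[symmetric] of_nat_le_iff by (rule card_UN_le[OF Q(1)])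
    also have "\<dots> \<le> (\<Sum>S\<in>Q. \<tau> * real (card \<Omega>))"
      by (intro sum_mono agree Q)
    also have "\<dots> \<le> (q + 1) * (\<tau> * real (card \<Omega>))"
      using cardQ pos by (auto intro!: mult_right_mono)
    finally have "C * real (card bad) \<le> C * ((q + 1) * (\<tau> * real (card \<Omega>)))"
      using pos by (intro mult_left_mono)
    with le show ?thesis unfolding eq by (simp add: K_def algebra_simps)
  qed
  have "(\<Sum>\<omega>\<in>\<Omega>. K) < (\<Sum>\<omega>\<in>\<Omega>. measure_pmf.expectation p (h \<omega>))"
    using \<Omega> big by (intro sum_strict_mono) auto
  also have "\<dots> = measure_pmf.expectation p (\<lambda>t. \<Sum>\<omega>\<in>\<Omega>. h \<omega> t)"
    using int by (intro Bochner_Integration.integral_sum[symmetric]) auto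
  also have "\<dots> \<le> real (card \<Omega>) * K"
    using int avg by (intro measure_pmf.integral_le_const) (auto simp: AE_measure_pmf_iff)
  finally show False by simp
qed

theorem theorem5p3:
  fixes \<epsilon> :: real
  assumes "\<epsilon> > 0"
  shows "\<exists>\<P> :: nat base_instance set.
           (\<forall>(X, \<J>, f)\<in>\<P>. submodular_base_instance (X, \<J>, f) \<and>
                          fractional_base_packing_number X \<J> \<ge> 2) \<and>
           requires_exponentially_many_queries (1 - exp (- 1 / 2) + \<epsilon>) \<P>"
proof -
  define \<alpha> :: real where "\<alpha> = 1 - exp (- 1 / 2) + \<epsilon>"
  have \<alpha>: "0 \<le> \<alpha>" using assms by (simp add: \<alpha>_def)
  have "(\<lambda>k. (1 + (- 1 / 2) / real k) ^ k) \<longlonglongrightarrow> exp (- 1 / 2 :: real)"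
    by (rule tendsto_exp_limit_sequentially)
  then have "\<forall>\<^sub>F k in sequentially. exp (- 1 / 2) - \<epsilon> / 4 < (1 + (- 1 / 2) / real k) ^ k"
    using assms by (intro order_tendstoD) auto
  then obtain k0 where k0: "\<And>k. k \<ge> k0 \<Longrightarrow> exp (- 1 / 2) - \<epsilon> / 4 < (1 + (- 1 / 2) / real k) ^ k"
    by (auto simp: eventually_sequentially)
  \<comment> \<open>Each side has \<open>l + 2\<close> blocks, enough to be within
    \<open>\<epsilon> / 4\<close> of the limit.\<close>
  define l where "l = k0"
  have l: "exp (- 1 / 2) - \<epsilon> / 4 < (1 - 1 / (2 * real (l + 2))) ^ (l + 2)"
    using k0[of "l + 2"] by (simp add: l_def)
  define M where "M = 2 * real (l + 2) + 2"
  \<comment> \<open>Makes \<open>\<kappa> * M\<^sup>2\<close> at most \<open>\<epsilon> / 4\<close>.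
    It is fixed before \<open>n\<close>, so that the threshold \<delta> below is a constant.\<close>
  define a where "a = min 1 (\<epsilon> / (4 * (6000 * (real (l + 2))\<^sup>2 * M\<^sup>2)))"
  define \<kappa> where "\<kappa> = 6000 * a * (real (l + 2))\<^sup>2"
  have M: "0 < M" "M = real (2 * l + 6)" by (simp_all add: M_def)
  have a: "0 < a" "a \<le> 1" using assms M by (auto simp: a_def)
  have \<kappa>: "0 \<le> \<kappa>" "6000 * a * (real (l + 2))\<^sup>2 \<le> \<kappa>" using a by (simp_all add: \<kappa>_def)
  have \<kappa>M: "\<kappa> * M\<^sup>2 \<le> \<epsilon> / 4"
  proof -
    define c where "c = 6000 * (real (l + 2))\<^sup>2 * M\<^sup>2"
    have c: "0 < c" using M by (simp add: c_def)
    have "\<kappa> * M\<^sup>2 = a * c" by (simp add: \<kappa>_def c_def)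
    also have "\<dots> \<le> \<epsilon> / (4 * c) * c"
      using c by (intro mult_right_mono) (simp_all add: a_def c_def)
    also have "\<dots> = \<epsilon> / 4" using c by simp
    finally show ?thesis .
  qed
  \<comment> \<open>The most that any base attains under the symmetric objective.\<close>
  define \<beta> where "\<beta> = 1 - (1 - 1 / (2 * real (l + 2))) ^ (l + 2) + \<kappa> * M\<^sup>2"
  define C where "C = 2 + \<kappa> * M\<^sup>2"
  have C: "0 \<le> C" using \<kappa> by (simp add: C_def)
  have \<beta>: "0 \<le> \<beta>" "\<beta> < \<alpha> - \<epsilon> / 4"
  proof -
    have "(1 - 1 / (2 * real (l + 2))) ^ (l + 2) \<le> 1"
      by (intro power_le_one) (simp_all add: divide_le_eq_1)
    then show "0 \<le> \<beta>" using \<kappa> by (simp add: \<beta>_def)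
    show "\<beta> < \<alpha> - \<epsilon> / 4" using l \<kappa>M assms by (simp add: \<beta>_def \<alpha>_def)
  qed
  define \<delta> where "\<delta> = exp (- 1 / a)"
  have \<delta>: "0 < \<delta>" "\<delta> \<le> 1" using a by (simp_all add: \<delta>_def)
  define \<tau> where "\<tau> n = 6 * exp (- (\<delta> * real n / 16))" for n
  \<comment> \<open>Half the decay rate of \<tau>, so that a union bound over \<open>q n + 1\<close>
    sets still leaves an exponentially small failure probability.\<close>
  define q where "q n = exp (\<delta> * real n / 32)" for n
  have "(\<lambda>n. 12 * C * exp (- (\<delta> / 32 * real n))) \<longlonglongrightarrow> 12 * C * 0"
  proof (intro tendsto_mult_left)
    have "LIM n sequentially. \<delta> / 32 * real n :> at_top"
      using \<delta> by (intro filterlim_tendsto_pos_mult_at_top[OF tendsto_const]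
          filterlim_real_sequentially) auto
    then show "(\<lambda>n. exp (- (\<delta> / 32 * real n))) \<longlonglongrightarrow> 0"
      by (intro filterlim_compose[OF exp_at_bot] filterlim_compose[OF filterlim_uminus_at_bot_at_top])
  qed
  then have "\<forall>\<^sub>F n in sequentially. 12 * C * exp (- (\<delta> / 32 * real n)) < \<epsilon> / 4"
    using assms by (intro order_tendstoD) auto
  then obtain n0 where n0: "\<And>n. n \<ge> n0 \<Longrightarrow> 12 * C * exp (- (\<delta> / 32 * real n)) < \<epsilon> / 4"
    by (auto simp: eventually_sequentially)
  have small: "C * ((q n + 1) * \<tau> n) < \<epsilon> / 4" if "n \<ge> n0" for n
  proof -
    have "(q n + 1) * \<tau> n \<le> (2 * q n) * \<tau> n"
      using \<delta> by (intro mult_right_mono) (simp_all add: q_def \<tau>_def)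
    also have "\<dots> = 12 * exp (- (\<delta> / 32 * real n))"
      by (simp add: q_def \<tau>_def exp_add[symmetric] field_simps)
    finally have "C * ((q n + 1) * \<tau> n) \<le> 12 * C * exp (- (\<delta> / 32 * real n))"
      using C mult_left_mono[of _ _ C] by fastforce
    with n0[OF that] show ?thesis by linarith
  qed
  define N0 where "N0 = max 1 n0"
  \<comment> \<open>With the symmetric objective in the family, the query bound also holds for the run on it, which
    the runs on the hidden objectives are compared with.\<close>
  define fam where "fam n = insert (symmetric_objective l \<kappa> n) (hidden_objective l a \<kappa> n ` rotations l n)"
    for n
  define \<P> where "\<P> = {(ground l n, indep l n, f) | n f. N0 \<le> n \<and> f \<in> fam n}"
  \<comment> \<open>With \<open>n\<close> groups the ground set has \<open>n * M\<close> elements,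
    and \<open>ln 2\<close> changes the base, so that the required number of queries is exactly
    \<open>q n\<close>.\<close>
  define c where "c = \<delta> / (32 * M * ln 2)"
  have c: "0 < c" using \<delta> M by (simp add: c_def)
  have powr_q: "2 powr (c * real (n * (2 * l + 6))) = q n" for n
  proof -
    have "c * real (n * (2 * l + 6)) * ln 2 = \<delta> * real n / 32"
      using M by (simp add: c_def M(2)[symmetric] field_simps del: of_nat_add of_nat_mult)
        (simp add: M(2) field_simps)
    then show ?thesis by (simp add: powr_def q_def mult.commute)
  qed
  have valid: "\<forall>(X, \<J>, f)\<in>\<P>. submodular_base_instance (X, \<J>, f) \<and>
      fractional_base_packing_number X \<J> \<ge> 2"
    using submodular_base_instance_hidden[OF _ a \<kappa>(2)] submodular_base_instance_symmetric[OF _ \<kappa>(1)]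
      packing_indep
    by (auto simp: \<P>_def fam_def N0_def)
  have sizes: "(\<lambda>P. card (fst P)) ` \<P> = (\<lambda>n. n * (2 * l + 6)) ` {N0..}"
    by (force simp: \<P>_def fam_def card_ground image_iff)
  have inf: "infinite ((\<lambda>P. card (fst P)) ` \<P>)"
    unfolding sizes by (subst finite_image_iff) (auto intro!: inj_onI simp: infinite_Ici)
  have hard: "\<exists>P\<in>\<P>. card (fst P) = n * (2 * l + 6) \<and> makes_at_least_queries (q n) A P"
    if A: "\<And>P. P \<in> \<P> \<Longrightarrow> achieves_approximation \<alpha> A P" and n: "N0 \<le> n" for A n
  proof (rule ccontr)
    assume none: "\<not> ?thesis"
    have few: "\<not> makes_at_least_queries (q n) A (ground l n, indep l n, f)" if "f \<in> fam n" for f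
    proof -
      have "(ground l n, indep l n, f) \<in> \<P>" using that n by (auto simp: \<P>_def)
      with none show ?thesis by (metis card_ground fst_conv)
    qed
    define p where "p = A (ground l n) (indep l n)"
    have n': "0 < n" "n0 \<le> n" using n by (auto simp: N0_def)
    have ach: "\<And>t. t \<in> set_pmf p \<Longrightarrow> queries_within (ground l n) t \<and> answer f t \<in> bases (indep l n)"
      "\<alpha> * opt_value (ground l n, indep l n, f) \<le> measure_pmf.expectation p (\<lambda>t. f (answer f t))"
      if "f \<in> fam n" for f
      using A[of "(ground l n, indep l n, f)"] that n
      by (auto simp: \<P>_def achieves_approximation_def p_def)
    have base_sub: "B \<subseteq> ground l n" if "B \<in> bases (indep l n)" for B
      using that bases_indep[OF n'(1)] by blast
    have "\<exists>\<rho>\<in>rotations l n. measure_pmf.expectation p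
        (\<lambda>t. hidden_objective l a \<kappa> n \<rho> (answer (hidden_objective l a \<kappa> n \<rho>) t))
        \<le> \<beta> + C * ((q n + 1) * \<tau> n)"
    proof (rule average_case_bound[where X = "ground l n" and g = "symmetric_objective l \<kappa> n"])
      show "finite (rotations l n)" by (intro finite_PiE) auto
      show "rotations l n \<noteq> {}" by (auto simp: PiE_eq_empty_iff lessThan_empty_iff)
      show "0 \<le> \<tau> n" by (simp add: \<tau>_def)
    next
      fix t assume t: "t \<in> set_pmf p"
      have g: "symmetric_objective l \<kappa> n \<in> fam n" by (simp add: fam_def)
      have "real (num_queries (symmetric_objective l \<kappa> n) t) \<le> q n"
        using few[OF g] t by (auto simp: makes_at_least_queries_def p_def)
      then show "queries_within (ground l n) t \<and> real (num_queries (symmetric_objective l \<kappa> n) t) \<le> q n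
          \<and> answer (symmetric_objective l \<kappa> n) t \<subseteq> ground l n
          \<and> symmetric_objective l \<kappa> n (answer (symmetric_objective l \<kappa> n) t) \<le> \<beta>"
        using ach(1)[OF g t] base_sub symmetric_objective_base[OF n'(1) _ \<kappa>(1)]
        by (simp add: \<beta>_def M_def)
    next
      fix t \<rho> assume "t \<in> set_pmf p" "\<rho> \<in> rotations l n"
      then have "answer (hidden_objective l a \<kappa> n \<rho>) t \<subseteq> ground l n"
        using ach(1) base_sub by (auto simp: fam_def)
      then show "0 \<le> hidden_objective l a \<kappa> n \<rho> (answer (hidden_objective l a \<kappa> n \<rho>) t)
          \<and> hidden_objective l a \<kappa> n \<rho> (answer (hidden_objective l a \<kappa> n \<rho>) t) \<le> C"
        using hidden_objective_bounds[OF n'(1) _ a \<kappa>(1)] by (simp add: C_def M_def)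
    next
      fix S assume S: "S \<subseteq> ground l n"
      have "{\<rho> \<in> rotations l n. hidden_objective l a \<kappa> n \<rho> S \<noteq> symmetric_objective l \<kappa> n S}
          \<subseteq> {\<rho> \<in> rotations l n. \<delta> < imbalance l (profile (hidden_class l \<rho>) n S)}"
        using hidden_objective_balanced[OF n'(1) S a(1)] by (force simp: \<delta>_def)
      then have "card {\<rho> \<in> rotations l n. hidden_objective l a \<kappa> n \<rho> S \<noteq> symmetric_objective l \<kappa> n S}
          \<le> card {\<rho> \<in> rotations l n. \<delta> < imbalance l (profile (hidden_class l \<rho>) n S)}"
        by (intro card_mono) (simp_all add: finite_PiE)
      then show "real (card {\<rho> \<in> rotations l n. hidden_objective l a \<kappa> n \<rho> S \<noteq> symmetric_objective l \<kappa> n S})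
          \<le> \<tau> n * real (card (rotations l n))"
        using imbalance_concentration[OF n'(1) S, of \<delta>] \<delta> by (simp add: \<tau>_def)
    qed (use \<beta> C in auto)
    then obtain \<rho> where \<rho>: "\<rho> \<in> rotations l n" and le: "measure_pmf.expectation p
        (\<lambda>t. hidden_objective l a \<kappa> n \<rho> (answer (hidden_objective l a \<kappa> n \<rho>) t))
        \<le> \<beta> + C * ((q n + 1) * \<tau> n)"
      by blast
    have "1 \<le> opt_value (ground l n, indep l n, hidden_objective l a \<kappa> n \<rho>)"
      unfolding opt_value_def prod.case
      by (rule order_trans[OF hidden_objective_hidden_base[OF n'(1) \<kappa>(1), of l a \<rho>] Max_ge])
        (simp_all add: finite_bases_indep hidden_base_in_bases n')
    then have "\<alpha> \<le> \<alpha> * opt_value (ground l n, indep l n, hidden_objective l a \<kappa> n \<rho>)"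
      using \<alpha> mult_left_mono[of 1 _ \<alpha>] by simp
    also have "\<dots> \<le> \<beta> + C * ((q n + 1) * \<tau> n)"
      using ach(2)[of "hidden_objective l a \<kappa> n \<rho>"] le \<rho> by (simp add: fam_def)
    also have "\<dots> < \<alpha>" using \<beta>(2) small[OF n'(2)] assms by linarith
    finally show False by simp
  qed
  have "requires_exponentially_many_queries \<alpha> \<P>"
    unfolding requires_exponentially_many_queries_def
  proof (intro conjI inf exI[of _ c] c allI impI ballI)
    fix A :: "nat value_oracle_algorithm" and m
    assume A: "\<forall>P\<in>\<P>. achieves_approximation \<alpha> A P" and "m \<in> (\<lambda>P. card (fst P)) ` \<P>"
    then obtain n where n: "N0 \<le> n" "m = n * (2 * l + 6)" unfolding sizes by auto
    show "\<exists>P\<in>\<P>. card (fst P) = m \<and> makes_at_least_queries (2 powr (c * real m)) A P"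
      using hard[of A n] A n(1) unfolding n(2) powr_q by blast
  qed
  with valid show ?thesis unfolding \<alpha>_def by blast
qed

end
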